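(* Let $N\in\mathbb N$ and let $\ell_1$ and $\ell_2$ be different integers with $1\le \ell_1,\ell_2\le N-2$. If $\ell_1+\ell_2\neq N-1$, then almost every complex-valued signal $x$ with support $\{0,\dots,N-1\}$ can be uniquely recovered from $|\widehat x|$, $\arg x[N-1-\ell_1]$, and $\arg x[N-1-\ell_2]$. If $\ell_1+\ell_2=N-1$, then the recovery is only unique up to conjugate reflections, that is, for almost every complex-valued signal $x$ with support $\{0,\dots,N-1\}$ the solutions of this recovery problem are exactly $x$ and the signal $\bigl(e^{i(\arg x[N-1-\ell_1]+\arg x[N-1-\ell_2])}\,\overline{x[N-1-n]}\bigr)_{n\in\mathbb Z}$.
   Context: A (discrete-time) signal is a sequence $x=(x[n])_{n\in\mathbb Z}$ of complex numbers. It has support $\{0,\dots,N-1\}$ if $x[n]=0$ for $n\notin\{0,\dots,N-1\}$ and $x[0]\neq0$, $x[N-1]\ne 0$ (interior values may vanish). Its Fourier transform is $\widehat x(\omega)=\sum_{n\in\mathbb Z}x[n]e^{-i\omega n}$, $\omega\in\mathbb R$, and $|\widehat x|$ is the function $\omega\mapsto|\widehat x(\omega)|$ (the Fourier intensity). Signals with support $\{0,\dots,N-1\}$ are identified with vectors $(\operatorname{Re}x[0],\operatorname{Im}x[0],\dots,\operatorname{Re}x[N-1],\operatorname{Im}x[N-1])\in\mathbb R^{2N}$; "almost every" means for all outside a set of $2N$-dimensional Lebesgue measure zero. Phases are understood modulo $2\pi$. The phase of $0$ is not uniquely defined, and the convention is that the condition $\arg z=\arg w$ counts as satisfied whenever $z=0$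 or $w=0$. A solution of the recovery problem for $x$ is a signal $y$ with support $\{0,\dots,N-1\}$ satisfying $|\widehat y|=|\widehat x|$, $\arg y[N-1-\ell_1]=\arg x[N-1-\ell_1]$ and $\arg y[N-1-\ell_2]=\arg x[N-1-\ell_2]$. "$x$ can be uniquely recovered" means that $y=x$ is the only solution. *)

theory Defs
  imports "HOL-Analysis.Analysis"
begin

type_synonym signal = "int \<Rightarrow> complex"

definition has_support :: "nat \<Rightarrow> signal \<Rightarrow> bool" where
  "has_support N x \<longleftrightarrow>
     (\<forall>n. n \<notin> {0..int N - 1} \<longrightarrow> x n = 0) \<and> x 0 \<noteq> 0 \<and> x (int N - 1) \<noteq> 0"

definition fourier :: "signal \<Rightarrow> real \<Rightarrow> complex" where
  "fourier x \<omega> = (\<Sum>\<^sub>\<infinity>n\<in>UNIV. x n * exp (- \<i> * of_real \<omega> * of_int n))"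

definition fourier_intensity :: "signal \<Rightarrow> real \<Rightarrow> real" where
  "fourier_intensity x = (\<lambda>\<omega>. cmod (fourier x \<omega>))"

text \<open>The library's \<^const>\<open>Arg\<close> takes values in $(-\pi,\pi]$, so for nonzero arguments equality of
  \<^const>\<open>Arg\<close> is equality of phases modulo $2\pi$. Zero matches every phase.\<close>

definition same_phase :: "complex \<Rightarrow> complex \<Rightarrow> bool" where
  "same_phase z w \<longleftrightarrow> z = 0 \<or> w = 0 \<or> Arg z = Arg w"

definition solutions :: "nat \<Rightarrow> int \<Rightarrow> int \<Rightarrow> signal \<Rightarrow> signal set" where
  "solutions N l1 l2 x =
     {y. has_support N y \<and> fourier_intensity y = fourier_intensity x \<and>
         same_phase (y (int N - 1 - l1)) (x (int N - 1 - l1)) \<and>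
         same_phase (y (int N - 1 - l2)) (x (int N - 1 - l2))}"

definition conj_reflection :: "nat \<Rightarrow> int \<Rightarrow> int \<Rightarrow> signal \<Rightarrow> signal" where
  "conj_reflection N l1 l2 x =
     (\<lambda>n. exp (\<i> * of_real (Arg (x (int N - 1 - l1)) + Arg (x (int N - 1 - l2)))) *
          cnj (x (int N - 1 - n)))"

text \<open>The vector of interleaved real and imaginary parts of $x[0],\dots,x[N-1]$. Since $N$ is a
  variable, $\mathbb R^{2N}$ is the set of extensional functions on \<^term>\<open>{..<2 * N}\<close>, and its
  Lebesgue measure is the completion of the product of \<^term>\<open>2 * N\<close> copies of
  \<^term>\<open>lborel :: real measure\<close>.\<close>

definition signal_coords :: "nat \<Rightarrow> signal \<Rightarrow> nat \<Rightarrow> real" where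
  "signal_coords N x =
     (\<lambda>k\<in>{..<2 * N}. if even k then Re (x (int (k div 2))) else Im (x (int (k div 2))))"

definition lebesgue_2N :: "nat \<Rightarrow> (nat \<Rightarrow> real) measure" where
  "lebesgue_2N N = completion (\<Pi>\<^sub>M k\<in>{..<2 * N}. (lborel :: real measure))"

definition almost_every_signal :: "nat \<Rightarrow> (signal \<Rightarrow> bool) \<Rightarrow> bool" where
  "almost_every_signal N P \<longleftrightarrow>
     (\<exists>Z \<in> null_sets (lebesgue_2N N).
        \<forall>x. has_support N x \<longrightarrow> signal_coords N x \<notin> Z \<longrightarrow> P x)"

end

theory Submission
  imports Defs "HOL-Computational_Algebra.Fundamental_Theorem_Algebra"
begin

text \<open>A signal supported on $\{0,\dots,n\}$ with $n = N - 1$ is a polynomial \<open>X\<close> of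
  degree \<open>n\<close> whose Fourier intensity is its modulus on the unit circle. A polynomial
  \<open>Y\<close> of degree at most \<open>n\<close> has the same modulus there exactly when, up to a
  unimodular constant, it arises from the factorization of \<open>X\<close> into linear factors by
  replacing the factors in some set \<open>J\<close> by their conjugate reflections
  (\<open>same_modulus_on_circle_imp_flip_prod\<close>). If \<open>Y\<close> agrees with
  \<open>X\<close> in phase at the indices \<open>k1\<close> and \<open>k2\<close>, then the unknown
  constant cancels in \<open>Y_k1 * cnj Y_k2 * cnj X_k1 * X_k2\<close>, and this number is real. It has
  to be shown that for almost every \<open>X\<close> this happens only for $J = \emptyset$, where
  \<open>Y\<close> is a multiple of \<open>X\<close>, and, if \<open>k1 + k2 = n\<close>, for the full
  set, where \<open>Y\<close> is a multiple of the reflection of \<open>X\<close>. The phases then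
  determine the constant (\<open>generic_solutions\<close>).

  The set of bad \<open>X\<close> is not described by an explicit equation in the coefficients, because
  the condition is on the roots. The coefficients of \<open>X\<close> and its roots are however moved
  simultaneously, and explicitly, by the Moebius substitutions $X \mapsto (z+s)^n X((az+b)/(z+s))$:
  these are linear on coefficients and send each linear factor to a linear factor. Fix \<open>s\<close>.
  For a squarefree \<open>X\<close> and a given \<open>J\<close>, the imaginary part of the above
  product is a real polynomial in $(a,b) \in \mathbb C^2$. To see that it is not zero, pick a root
  $\beta$ with index in \<open>J\<close> and let $(a,b)$ approach $(\beta, s\beta)$, in the direction
  $(1,u)$. After rescaling, the factor of $\beta$ becomes $z+u$ while all the others become $z+s$, so
  that the limit is a model configuration depending only on \<open>u\<close>, \<open>s\<close> and the
  size of \<open>J\<close>, where it can be checked that the product is not always real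
  (\<open>phase_form_model_nonreal\<close>, \<open>phase_form_nonreal_on_orbit\<close>).

  Hence for almost every \<open>X\<close> almost every substitution leads out of the bad set. By Fubini
  there is an invertible substitution \<open>T\<close> such that \<open>T X\<close> is not bad for
  almost every \<open>X\<close> (\<open>AE_not_ambiguous\<close>). Since \<open>T\<close> is a
  surjective linear map, the bad set itself is null (\<open>AE_surj_additive\<close>); the dimension
  being a variable, this is deduced from translation invariance by another application of Fubini rather
  than from a determinant formula.\<close>

section \<open>Conjugate reflection and polynomials of equal modulus on the circle\<close>

lemma poly_eq_sum_coeff:
  fixes p :: "complex poly"
  assumes "degree p \<le> n"
  shows "poly p z = (\<Sum>k\<le>n. coeff p k * z ^ k)"
  by (subst poly_as_sum_of_monoms'[OF assms, symmetric])
     (simp add: poly_sum poly_monom)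

text \<open>The reflection $z^n\,\overline{p(1/\bar z)}$. The formal degree \<open>n\<close> is a parameter, so that
  the map is conjugate linear on all polynomials of degree at most \<open>n\<close>, in contrast to
  \<^const>\<open>reflect_poly\<close>.\<close>

definition creflect :: "nat \<Rightarrow> complex poly \<Rightarrow> complex poly" where
  "creflect n p = (\<Sum>k\<le>n. monom (cnj (coeff p (n - k))) k)"

lemma coeff_creflect:
  "coeff (creflect n p) k = (if k \<le> n then cnj (coeff p (n - k)) else 0)"
  by (simp add: creflect_def coeff_sum)

lemma degree_creflect: "degree (creflect n p) \<le> n"
  by (rule degree_le) (simp add: coeff_creflect)

lemma poly_creflect:
  assumes "degree p \<le> n" "z \<noteq> 0"
  shows "poly (creflect n p) z = z ^ n * cnj (poly p (inverse (cnj z)))"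
proof -
  have "poly (creflect n p) z = (\<Sum>k\<le>n. cnj (coeff p (n - k)) * z ^ k)"
    by (simp add: creflect_def poly_sum poly_monom)
  also have "\<dots> = (\<Sum>k\<le>n. cnj (coeff p k) * z ^ (n - k))"
    by (rule sum.reindex_bij_witness[where i="\<lambda>k. n - k" and j="\<lambda>k. n - k"]) auto
  also have "\<dots> = (\<Sum>k\<le>n. z ^ n * (cnj (coeff p k) * inverse z ^ k))"
    using assms(2) by (intro sum.cong) (auto simp: power_diff power_inverse field_simps)
  also have "\<dots> = z ^ n * cnj (poly p (inverse (cnj z)))"
    by (simp add: poly_eq_sum_coeff[OF assms(1)] sum_distrib_left)
  finally show ?thesis .
qed

lemma poly_times_creflect_on_circle:
  assumes "degree p \<le> n" "cmod z = 1"
  shows "poly (p * creflect n p) z = z ^ n * of_real ((cmod (poly p z))\<^sup>2)"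
proof -
  have "z * cnj z = 1" using assms(2) by (simp add: complex_norm_square[symmetric])
  then have "inverse (cnj z) = z" by (metis inverse_unique mult.commute)
  moreover have "z \<noteq> 0" using assms(2) by auto
  ultimately show ?thesis
    using poly_creflect[OF assms(1), of z] by (simp add: complex_norm_square[symmetric] mult_ac del: of_real_power)
qed

lemma creflect_smult: "creflect n (smult c p) = smult (cnj c) (creflect n p)"
  by (rule poly_eqI) (simp add: coeff_creflect)

lemma cmod_creflect_on_circle:
  assumes "degree p \<le> n" "cmod z = 1"
  shows "cmod (poly (creflect n p) z) = cmod (poly p z)"
proof -
  have "z * cnj z = 1" using assms(2) by (simp add: complex_norm_square[symmetric])
  then have "inverse (cnj z) = z" by (metis inverse_unique mult.commute)
  moreover have "z \<noteq> 0" using assms(2) by auto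
  ultimately have "poly (creflect n p) z = z ^ n * cnj (poly p z)"
    using poly_creflect[OF assms(1), of z] by simp
  then show ?thesis using assms(2) by (simp only: norm_mult norm_power complex_mod_cnj) simp
qed

lemma infinite_unit_circle: "infinite {z. cmod z = 1}"
proof
  assume fin: "finite {z. cmod z = 1}"
  have eq: "{z. cmod z = 1} = sphere 0 1" by (auto simp: dist_norm)
  have "connected {z. cmod z = 1}" unfolding eq by (rule connected_sphere) simp
  with fin obtain a where "{z. cmod z = 1} = {} \<or> {z. cmod z = 1} = {a}"
    using connected_finite_iff_sing by blast
  moreover have "1 \<in> {z. cmod z = 1}" "-1 \<in> {z. cmod z = 1}" by simp_all
  ultimately have "(1::complex) = -1" by (metis empty_iff singletonD)
  then show False by simp
qed

lemma complex_poly_eqI_infinite: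
  fixes p q :: "complex poly"
  assumes "infinite A" "\<And>z. z \<in> A \<Longrightarrow> poly p z = poly q z"
  shows "p = q"
proof (rule ccontr)
  assume "p \<noteq> q"
  then have "finite {z. poly (p - q) z = 0}" by (intro poly_roots_finite) simp
  moreover have "A \<subseteq> {z. poly (p - q) z = 0}" using assms(2) by auto
  ultimately show False using assms(1) finite_subset by blast
qed

text \<open>On the circle $|p|^2 = z^{-n} \cdot p \cdot p^*$, with $p^*$ the reflection, so that proportional moduli
  give a polynomial identity. Finitely many exceptional points are tolerated in order that a factor with a
  zero on the circle can be cancelled from a hypothesis of this form.\<close>

lemma times_creflect_eqI:
  assumes "degree p \<le> n" "degree q \<le> n"
    and "finite {z. cmod z = 1 \<and> cmod (poly p z) \<noteq> C * cmod (poly q z)}"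
  shows "p * creflect n p = smult (of_real (C\<^sup>2)) (q * creflect n q)"
proof (rule complex_poly_eqI_infinite)
  show "infinite ({z. cmod z = 1} - {z. cmod z = 1 \<and> cmod (poly p z) \<noteq> C * cmod (poly q z)})"
    using infinite_unit_circle assms(3) by simp
  fix z assume "z \<in> {z. cmod z = 1} - {z. cmod z = 1 \<and> cmod (poly p z) \<noteq> C * cmod (poly q z)}"
  then have z: "cmod z = 1" "cmod (poly p z) = C * cmod (poly q z)" by auto
  show "poly (p * creflect n p) z = poly (smult (of_real (C\<^sup>2)) (q * creflect n q)) z"
    unfolding poly_smult poly_times_creflect_on_circle[OF assms(1) z(1)]
      poly_times_creflect_on_circle[OF assms(2) z(1)] z(2)
    by (simp add: power_mult_distrib mult_ac)
qed

text \<open>The product over \<open>S\<close> of the linear factors \<open>c j + d j * z\<close>, those with index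
  in \<open>J\<close> being replaced by their conjugate reflections. Coefficient pairs are used instead of
  roots because they depend polynomially on a Moebius substitution.\<close>

definition flip_prod :: "('i \<Rightarrow> complex) \<Rightarrow> ('i \<Rightarrow> complex) \<Rightarrow> 'i set \<Rightarrow> 'i set \<Rightarrow> complex poly" where
  "flip_prod c d S J =
     (\<Prod>j\<in>S. if j \<in> J then [:cnj (d j), cnj (c j):] else [:c j, d j:])"

lemma degree_flip_prod: "finite S \<Longrightarrow> degree (flip_prod c d S J) \<le> card S"
proof (induction S rule: finite_induct)
  case (insert j S)
  have "degree ((if j \<in> J then [:cnj (d j), cnj (c j):] else [:c j, d j:]) * flip_prod c d S J)
     \<le> 1 + card S"
    by (rule order.trans[OF degree_mult_le add_mono[OF _ insert.IH]]) auto
  with insert.hyps show ?case by (simp add: flip_prod_def)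
qed (simp add: flip_prod_def)

lemma cmod_flipped_linear:
  assumes "cmod z = 1"
  shows "cmod (poly [:cnj d, cnj c:] z) = cmod (poly [:c, d:] z)"
proof -
  have *: "z * cnj z = 1" using assms by (simp add: complex_norm_square[symmetric])
  have "z * cnj (poly [:c, d:] z) = z * cnj c + cnj d * (z * cnj z)"
    by (simp add: algebra_simps)
  then have "poly [:cnj d, cnj c:] z = z * cnj (poly [:c, d:] z)"
    by (simp add: *)
  then have "cmod (poly [:cnj d, cnj c:] z) = cmod z * cmod (cnj (poly [:c, d:] z))"
    by (simp only: norm_mult)
  then show ?thesis using assms by (simp only: complex_mod_cnj mult_1_left)
qed

lemma flip_prod_insert:
  assumes "finite S" "j \<notin> S"
  shows "flip_prod c d (insert j S) J =
     (if j \<in> J then [:cnj (d j), cnj (c j):] else [:c j, d j:]) * flip_prod c d S J"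
  using assms by (simp add: flip_prod_def)

lemma flip_prod_cong:
  "J \<inter> S = K \<inter> S \<Longrightarrow> flip_prod c d S J = flip_prod c d S K"
  unfolding flip_prod_def by (intro prod.cong) auto

lemma root_linear_dvd:
  fixes p :: "complex poly"
  assumes "b \<noteq> 0" "poly p (- a / b) = 0"
  obtains q where "p = [:a, b:] * q" "degree q = degree p - 1"
proof -
  from assms(2) obtain q where q: "p = [:- (- a / b), 1:] * q"
    by (meson dvdE poly_eq_0_iff_dvd)
  have "[:a, b:] = smult b [:- (- a / b), 1:]" using assms(1) by simp
  then have eq: "p = [:a, b:] * smult (inverse b) q"
    unfolding q using assms(1) by (simp only: mult_smult_left mult_smult_right smult_smult) simp
  show ?thesis
  proof (rule that[OF eq])
    show "degree (smult (inverse b) q) = degree p - 1"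
    proof (cases "q = 0")
      case False
      then have "degree p = 1 + degree q" unfolding q by (subst degree_mult_eq) auto
      then show ?thesis using assms(1) by simp
    qed (use q in simp)
  qed
qed

text \<open>The root \<open>r\<close> of a linear factor is a zero of $Y Y^*$, hence \<open>r\<close> or $1/\bar r$
  is a zero of \<open>Y\<close>, so that the factor or its reflection divides \<open>Y\<close>. Both have
  the same modulus on the circle, and the division reduces the claim to one factor less.\<close>

lemma same_modulus_on_circle_imp_flip_prod:
  fixes c d :: "'i \<Rightarrow> complex"
  assumes "finite S" "\<And>j. j \<in> S \<Longrightarrow> c j \<noteq> 0 \<and> d j \<noteq> 0" "degree Y \<le> card S"
    and "finite {z. cmod z = 1 \<and> cmod (poly Y z) \<noteq> C * cmod (poly (flip_prod c d S {}) z)}"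
  shows "\<exists>J\<subseteq>S. \<exists>lam. Y = smult lam (flip_prod c d S J)"
  using assms
proof (induction S arbitrary: Y rule: finite_induct)
  case empty
  then obtain a where "Y = [:a:]" using degree0_coeffs by auto
  then have "Y = smult a (flip_prod c d {} {})" by (simp add: flip_prod_def)
  then show ?case by blast
next
  case (insert j S)
  define X where "X = flip_prod c d (insert j S) {}"
  define r where "r = - c j / d j"
  have cd: "c j \<noteq> 0" "d j \<noteq> 0" using insert.prems(1) by auto
  have rnz: "r \<noteq> 0" using cd by (simp add: r_def)
  have degX: "degree X \<le> card (insert j S)"
    unfolding X_def by (rule degree_flip_prod) (use insert in auto)
  have Xr: "poly X r = 0"
    unfolding X_def flip_prod_insert[OF insert.hyps] using cd by (simp add: r_def)
  have "Y * creflect (card (insert j S)) Y =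
        smult (of_real (C\<^sup>2)) (X * creflect (card (insert j S)) X)"
    by (rule times_creflect_eqI[OF insert.prems(2) degX]) (use insert.prems(3) in \<open>simp add: X_def\<close>)
  then have "poly (Y * creflect (card (insert j S)) Y) r = 0"
    using Xr by simp
  then have "poly Y r = 0 \<or> poly Y (inverse (cnj r)) = 0"
    using poly_creflect[OF insert.prems(2) rnz] rnz by auto
  then obtain K where K: "K \<subseteq> {j}"
    and Kr: "poly Y (- (if j \<in> K then cnj (d j) else c j) / (if j \<in> K then cnj (c j) else d j)) = 0"
  proof
    assume "poly Y r = 0" then show ?thesis by (intro that[of "{}"]) (auto simp: r_def)
  next
    assume "poly Y (inverse (cnj r)) = 0"
    moreover have "inverse (cnj r) = - cnj (d j) / cnj (c j)" using cd by (simp add: r_def field_simps)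
    ultimately show ?thesis by (intro that[of "{j}"]) auto
  qed
  define L where "L = (if j \<in> K then [:cnj (d j), cnj (c j):] else [:c j, d j:])"
  have L2: "L = [:if j \<in> K then cnj (d j) else c j, if j \<in> K then cnj (c j) else d j:]"
    by (simp add: L_def)
  have nz: "(if j \<in> K then cnj (c j) else d j) \<noteq> 0" using cd by auto
  obtain Q where Q: "Y = L * Q" "degree Q = degree Y - 1"
    unfolding L2 using root_linear_dvd[OF nz Kr] .
  have Lmod: "cmod (poly L z) = cmod (poly [:c j, d j:] z)" if "cmod z = 1" for z
    using cmod_flipped_linear[OF that] by (simp add: L_def)
  have "finite {z. cmod z = 1 \<and> cmod (poly Q z) \<noteq> C * cmod (poly (flip_prod c d S {}) z)}"
  proof (rule finite_subset)
    show "{z. cmod z = 1 \<and> cmod (poly Q z) \<noteq> C * cmod (poly (flip_prod c d S {}) z)} \<subseteq>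
      {z. cmod z = 1 \<and> cmod (poly Y z) \<noteq> C * cmod (poly X z)} \<union> {z. poly [:c j, d j:] z = 0}"
    proof
      fix z assume z: "z \<in> {z. cmod z = 1 \<and> cmod (poly Q z) \<noteq> C * cmod (poly (flip_prod c d S {}) z)}"
      then have z1: "cmod z = 1" by simp
      have "cmod (poly Y z) = cmod (poly [:c j, d j:] z) * cmod (poly Q z)"
        "C * cmod (poly X z) = cmod (poly [:c j, d j:] z) * (C * cmod (poly (flip_prod c d S {}) z))"
        unfolding Q(1) X_def flip_prod_insert[OF insert.hyps] poly_mult norm_mult Lmod[OF z1]
        by (simp_all add: mult_ac)
      then show "z \<in> {z. cmod z = 1 \<and> cmod (poly Y z) \<noteq> C * cmod (poly X z)} \<union> {z. poly [:c j, d j:] z = 0}"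
        using z by auto
    qed
    show "finite ({z. cmod z = 1 \<and> cmod (poly Y z) \<noteq> C * cmod (poly X z)} \<union> {z. poly [:c j, d j:] z = 0})"
      using insert.prems(3) poly_roots_finite[of "[:c j, d j:]"] cd unfolding X_def by simp
  qed
  moreover have "degree Q \<le> card S" using Q(2) insert.prems(2) insert.hyps by simp
  ultimately obtain J lam where J: "J \<subseteq> S" "Q = smult lam (flip_prod c d S J)"
    using insert.IH[of Q] insert.prems(1) by auto
  have "flip_prod c d (insert j S) (J \<union> K) = L * flip_prod c d S J"
  proof -
    have "(J \<union> K) \<inter> S = J \<inter> S" using K insert.hyps by auto
    moreover have "j \<in> J \<union> K \<longleftrightarrow> j \<in> K" using J insert.hyps by auto
    ultimately show ?thesis
      unfolding flip_prod_insert[OF insert.hyps] L_def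
      using flip_prod_cong[of "J \<union> K" S J c d] by simp
  qed
  then have "Y = smult lam (flip_prod c d (insert j S) (J \<union> K))"
    using Q(1) J(2) by (simp add: mult_smult_right)
  moreover have "J \<union> K \<subseteq> insert j S" using J K by auto
  ultimately show ?case by blast
qed

lemma creflect_flip_prod:
  assumes "finite S"
  shows "creflect (card S) (flip_prod c d S {}) = flip_prod c d S S"
proof (rule complex_poly_eqI_infinite)
  show "infinite (UNIV - {0::complex})" by (simp add: infinite_UNIV_char_0)
  fix z :: complex assume "z \<in> UNIV - {0}"
  then have z: "z \<noteq> 0" by simp
  have "poly (creflect (card S) (flip_prod c d S {})) z =
    z ^ card S * cnj (poly (flip_prod c d S {}) (inverse (cnj z)))"
    by (rule poly_creflect[OF degree_flip_prod[OF assms] z])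
  also have "\<dots> = (\<Prod>j\<in>S. z * cnj (poly [:c j, d j:] (inverse (cnj z))))"
    by (simp add: flip_prod_def poly_prod prod.distrib)
  also have "\<dots> = (\<Prod>j\<in>S. poly [:cnj (d j), cnj (c j):] z)"
    using z by (intro prod.cong) (auto simp: algebra_simps)
  also have "\<dots> = poly (flip_prod c d S S) z"
    by (simp add: flip_prod_def poly_prod)
  finally show "poly (creflect (card S) (flip_prod c d S {})) z = poly (flip_prod c d S S) z" .
qed

section \<open>Moebius substitutions\<close>

text \<open>For $U = az+b$ and $V = cz+d$ this is $V^n\,p(U/V)$, that is, the substitution of \<open>(U, V)\<close>
  into the binary form of degree \<open>n\<close> attached to \<open>p\<close>.\<close>

definition hsubst :: "nat \<Rightarrow> complex poly \<Rightarrow> complex poly \<Rightarrow> complex poly \<Rightarrow> complex poly" where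
  "hsubst n U V p = (\<Sum>k\<le>n. smult (coeff p k) (U ^ k * V ^ (n - k)))"

lemma hsubst_linear_mult:
  assumes "degree p \<le> n"
  shows "hsubst (Suc n) U V ([:c, d:] * p) = (smult d U + smult c V) * hsubst n U V p"
proof -
  have co: "coeff ([:c, d:] * p) k = c * coeff p k + (if k = 0 then 0 else d * coeff p (k - 1))" for k
    by (cases k) (simp_all add: mult_pCons_left)
  have top: "coeff p (Suc n) = 0" using assms by (intro coeff_eq_0) simp
  have "hsubst (Suc n) U V ([:c, d:] * p) =
     (\<Sum>k\<le>Suc n. smult (c * coeff p k) (U ^ k * V ^ (Suc n - k))) +
     (\<Sum>k\<le>Suc n. smult (if k = 0 then 0 else d * coeff p (k - 1)) (U ^ k * V ^ (Suc n - k)))"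
    unfolding hsubst_def co by (simp add: smult_add_left sum.distrib)
  also have "(\<Sum>k\<le>Suc n. smult (c * coeff p k) (U ^ k * V ^ (Suc n - k))) =
     smult c V * hsubst n U V p"
    unfolding hsubst_def sum_distrib_left
    by (simp add: top Suc_diff_le mult_ac)
  also have "(\<Sum>k\<le>Suc n. smult (if k = 0 then 0 else d * coeff p (k - 1)) (U ^ k * V ^ (Suc n - k))) =
     smult d U * hsubst n U V p"
    unfolding hsubst_def sum_distrib_left
    by (subst sum.atMost_Suc_shift) (simp add: mult_ac)
  finally show ?thesis by (simp add: algebra_simps)
qed

lemma hsubst_flip_prod:
  assumes "finite S"
  shows "hsubst (card S) U V (flip_prod c d S {}) = (\<Prod>j\<in>S. smult (d j) U + smult (c j) V)"
  using assms
proof (induction S rule: finite_induct)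
  case (insert j S)
  have "hsubst (card (insert j S)) U V (flip_prod c d (insert j S) {}) =
     hsubst (Suc (card S)) U V ([:c j, d j:] * flip_prod c d S {})"
    using insert.hyps by (simp add: flip_prod_insert)
  also have "\<dots> = (smult (d j) U + smult (c j) V) * hsubst (card S) U V (flip_prod c d S {})"
    by (rule hsubst_linear_mult) (rule degree_flip_prod[OF insert.hyps(1)])
  finally show ?case using insert by simp
qed (simp add: hsubst_def flip_prod_def)

lemma hsubst_smult: "hsubst n U V (smult c p) = smult c (hsubst n U V p)"
  by (rule poly_eqI) (simp add: hsubst_def coeff_sum sum_distrib_left mult_ac)

lemma hsubst_add: "hsubst n U V (p + q) = hsubst n U V p + hsubst n U V q"
  by (simp add: hsubst_def smult_add_left sum.distrib)

lemma hsubst_sum: "hsubst n U V (\<Sum>i\<in>A. f i) = (\<Sum>i\<in>A. hsubst n U V (f i))"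
  by (induction A rule: infinite_finite_induct) (simp_all add: hsubst_add, simp_all add: hsubst_def)

text \<open>When $as \ne b$ the inverse Moebius transformation exists: both \<open>1\<close> and \<open>z\<close>
  are linear combinations of \<open>az+b\<close> and \<open>z+s\<close>, so every monomial is the image of
  a product of linear factors.\<close>

lemma hsubst_surj:
  assumes "a * s \<noteq> b" "degree q \<le> n"
  obtains p where "degree p \<le> n" "hsubst n [:b, a:] [:s, 1:] p = q"
proof -
  define D where "D = a * s - b"
  have D: "D \<noteq> 0" using assms(1) by (simp add: D_def)
  \<comment> \<open>The first \<open>k\<close> of the \<open>n\<close> linear forms in \<open>(U, V)\<close> equal
    \<open>z\<close>, the others equal \<open>1\<close>.\<close>
  define c d :: "nat \<Rightarrow> nat \<Rightarrow> complex" where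
    "c k j = (if j < k then - b / D else a / D)" and "d k j = (if j < k then s / D else - 1 / D)" for k j
  have lin: "smult (d k j) [:b, a:] + smult (c k j) [:s, 1:] = (if j < k then [:0, 1:] else 1)" for k j
  proof -
    have "a * s / D - b / D = 1" using D by (simp add: D_def flip: diff_divide_distrib)
    then show ?thesis by (simp add: c_def d_def one_pCons algebra_simps)
  qed
  have mon: "hsubst n [:b, a:] [:s, 1:] (flip_prod (c k) (d k) {..<n} {}) = monom 1 k" if "k \<le> n" for k
  proof -
    have "hsubst (card {..<n}) [:b, a:] [:s, 1:] (flip_prod (c k) (d k) {..<n} {}) =
      (\<Prod>j<n. if j < k then [:0, 1:] else 1)"
      unfolding hsubst_flip_prod[OF finite_lessThan] lin ..
    also have "\<dots> = (\<Prod>j\<in>{..<n} \<inter> {..<k}. [:0, 1:])"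
      by (subst prod.inter_restrict) auto
    also have "{..<n} \<inter> {..<k} = {..<k}" using that by auto
    finally show ?thesis by (simp add: monom_altdef)
  qed
  define p where "p = (\<Sum>k\<le>n. smult (coeff q k) (flip_prod (c k) (d k) {..<n} {}))"
  have "degree p \<le> n"
    unfolding p_def by (intro degree_sum_le order.trans[OF degree_smult_le])
      (use degree_flip_prod[of "{..<n}"] in auto)
  moreover have "hsubst n [:b, a:] [:s, 1:] p = q"
    unfolding p_def hsubst_sum hsubst_smult
    using mon poly_as_sum_of_monoms'[OF assms(2)] by (simp add: smult_monom)
  ultimately show ?thesis using that by blast
qed

section \<open>The phase form on the model configuration\<close>

text \<open>If \<open>Y\<close> and \<open>X\<close> have equal phases at both indices, this product is a
  nonnegative real number, and the condition is insensitive to a scaling of \<open>Y\<close> by any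
  complex factor.\<close>

definition phase_form :: "nat \<Rightarrow> nat \<Rightarrow> complex poly \<Rightarrow> complex poly \<Rightarrow> complex" where
  "phase_form k1 k2 Y X =
     coeff Y k1 * cnj (coeff Y k2) * cnj (coeff X k1) * coeff X k2"

lemma phase_form_smult:
  "phase_form k1 k2 (smult a Y) (smult b X) =
     of_real ((cmod a)\<^sup>2 * (cmod b)\<^sup>2) * phase_form k1 k2 Y X"
proof -
  have "phase_form k1 k2 (smult a Y) (smult b X) = (a * cnj a) * (b * cnj b) * phase_form k1 k2 Y X"
    by (simp add: phase_form_def mult_ac)
  then show ?thesis by (simp add: complex_norm_square[symmetric])
qed

lemma coeff_linear_mult:
  fixes p :: "'a::comm_ring_1 poly"
  assumes "k \<ge> 1"
  shows "coeff ([:a, b:] * p) k = a * coeff p k + b * coeff p (k - 1)"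
  using assms by (cases k) (simp_all add: mult_pCons_left)

lemma coeff_linear_mult_pos:
  fixes p :: "real poly"
  assumes "a > 0" "b > 0" "degree p \<le> n" "\<And>k. k \<le> n \<Longrightarrow> coeff p k > 0" "k \<le> Suc n"
  shows "coeff ([:a, b:] * p) k > 0"
proof (cases k)
  case 0 then show ?thesis using assms by simp
next
  case (Suc i)
  have "coeff p k \<ge> 0"
    using assms(3) assms(4)[of k] by (cases "k \<le> n") (auto simp: coeff_eq_0)
  moreover have "coeff p i > 0" using assms(5) Suc by (intro assms(4)) simp
  ultimately show ?thesis using assms(1,2) Suc
    by (subst coeff_linear_mult) (simp_all add: add_nonneg_pos)
qed

lemma coeff_two_linear_powers_pos:
  fixes s :: real
  assumes "s > 0" "k \<le> p + q"
  shows "coeff ([:s, 1:] ^ p * [:1, s:] ^ q) k > 0"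
proof -
  have deg: "degree ([:s, 1:] ^ p * [:1, s:] ^ q) \<le> p + q" for p q
    by (rule order.trans[OF degree_mult_le], rule add_mono; rule order.trans[OF degree_power_le]) simp_all
  have q: "\<forall>k\<le>q. coeff ([:1, s:] ^ q) k > 0" for q
  proof (induction q)
    case (Suc q)
    show ?case unfolding power_Suc
    proof (intro allI impI coeff_linear_mult_pos[where n=q])
      show "degree ([:1, s:] ^ q) \<le> q" using deg[of 0 q] by simp
    qed (use Suc assms(1) in auto)
  qed simp
  have "\<forall>k\<le>p + q. coeff ([:s, 1:] ^ p * [:1, s:] ^ q) k > 0" for p
  proof (induction p)
    case (Suc p)
    have "\<forall>k\<le>Suc (p + q). coeff ([:s, 1:] * ([:s, 1:] ^ p * [:1, s:] ^ q)) k > 0"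
    proof (intro allI impI coeff_linear_mult_pos[where n="p + q"])
      show "degree ([:s, 1:] ^ p * [:1, s:] ^ q) \<le> p + q" by (rule deg)
    qed (use Suc assms(1) in auto)
    then show ?case by (simp only: power_Suc mult.assoc add_Suc)
  qed (use q in simp)
  then show ?thesis using assms(2) by simp
qed

text \<open>This is the coefficient form of $(z+s)\,f' = (n-1) f$ for $f = (z+s)^{n-1}$.\<close>

lemma coeff_ratio_linear_power:
  fixes s :: real
  assumes "1 \<le> k" "k \<le> n"
  shows "s * k * coeff ([:s, 1:] ^ (n - 1)) k = (n - k) * coeff ([:s, 1:] ^ (n - 1)) (k - 1)"
proof -
  define c where "c = coeff ([:s, 1:] ^ (n - 1))"
  have "[:s, 1:] * pderiv ([:s, 1:] ^ (n - 1)) = smult (of_nat (n - 1)) ([:s, 1:] ^ (n - 1))"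
    by (cases "n - 1") (simp_all add: pderiv_power pderiv_pCons mult_ac del: power_Suc,
        simp_all add: power_Suc)
  then have "coeff ([:s, 1:] * pderiv ([:s, 1:] ^ (n - 1))) (k - 1) = (n - 1) * c (k - 1)"
    by (simp add: c_def)
  moreover have "coeff ([:s, 1:] * pderiv ([:s, 1:] ^ (n - 1))) (k - 1) = s * k * c k + (k - 1) * c (k - 1)"
  proof (cases "k = 1")
    case False
    then show ?thesis using assms
      by (subst coeff_linear_mult) (simp_all add: coeff_pderiv c_def Suc_diff_Suc eval_nat_numeral algebra_simps)
  qed (simp add: coeff_pderiv c_def)
  ultimately show ?thesis using assms unfolding c_def[symmetric] by (simp add: algebra_simps of_nat_diff)
qed

text \<open>For $f = (z+s)^p (1+sz)^q$ one has $(1+sz) f' = s(p+q) f + p(1-s^2)(z+s)^{p-1}(1+sz)^q$, because $(1+sz)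
  - s(z+s) = 1-s^2$. Comparing coefficients gives the ratio of consecutive coefficients exactly when $s =
  1$, and a strict inequality when $0 < s < 1$ and $p > 0$.\<close>

lemma coeff_recurrence_two_linear_powers:
  fixes s :: real
  assumes "1 \<le> k" "k \<le> p + q + 1"
  defines "h \<equiv> coeff ([:s, 1:] ^ p * [:1, s:] ^ q)"
  shows "k * h k = s * (p + q + 1 - k) * h (k - 1)
           + p * (1 - s\<^sup>2) * coeff ([:s, 1:] ^ (p - 1) * [:1, s:] ^ q) (k - 1)"
proof -
  define A B where "A = [:s, 1:]" and "B = [:1, s:]"
  have dA: "pderiv A = 1" and dB: "pderiv B = [:s:]" by (simp_all add: A_def B_def pderiv_pCons one_pCons)
  have BA: "B = smult s A + [:1 - s\<^sup>2:]" by (simp add: A_def B_def power2_eq_square)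
  have A1: "smult (of_nat p) (A ^ p) = smult (of_nat p) (A ^ (p - 1) * A)" by (cases p) (simp_all add: mult.commute)
  have B1: "smult (of_nat q) (B ^ (q - 1) * B) = smult (of_nat q) (B ^ q)" by (cases q) (simp_all add: mult.commute)
  have "B * pderiv (A ^ p * B ^ q) =
      smult (of_nat p) (A ^ (p - 1)) * B ^ q * B + A ^ p * [:s:] * smult (of_nat q) (B ^ (q - 1) * B)"
    by (simp add: pderiv_mult pderiv_power dA dB algebra_simps)
  also have "\<dots> = smult (of_nat p) (A ^ (p - 1)) * B ^ q * (smult s A + [:1 - s\<^sup>2:]) +
      A ^ p * [:s:] * smult (of_nat q) (B ^ q)"
    unfolding B1 using BA by simp
  also have "\<dots> = smult s (smult (of_nat p) (A ^ (p - 1) * A)) * B ^ q +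
      smult (of_nat p * (1 - s\<^sup>2)) (A ^ (p - 1) * B ^ q) + smult (s * of_nat q) (A ^ p * B ^ q)"
    by (simp add: algebra_simps smult_add_right)
  also have "\<dots> = smult (s * of_nat (p + q)) (A ^ p * B ^ q)
      + smult (of_nat p * (1 - s\<^sup>2)) (A ^ (p - 1) * B ^ q)"
    unfolding A1[symmetric] by (simp add: smult_add_left algebra_simps)
  finally have eq: "B * pderiv (A ^ p * B ^ q) = smult (s * of_nat (p + q)) (A ^ p * B ^ q)
      + smult (of_nat p * (1 - s\<^sup>2)) (A ^ (p - 1) * B ^ q)" .
  have "coeff (B * pderiv (A ^ p * B ^ q)) (k - 1) = k * h k + s * (k - 1) * h (k - 1)"
  proof (cases "k = 1")
    case False
    then show ?thesis using assms(1) unfolding B_def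
      by (subst coeff_linear_mult)
        (simp_all add: coeff_pderiv h_def Suc_diff_Suc eval_nat_numeral algebra_simps A_def)
  qed (simp add: coeff_pderiv h_def A_def B_def)
  then show ?thesis
    unfolding eq using assms(1,2) by (simp add: h_def A_def B_def algebra_simps of_nat_diff)
qed

text \<open>The expression is $\overline{f_1(u)} f_2(u)$ with real quadratics $f_i$. If it is real for all complex
  \<open>u\<close>, then $f_1$ and $f_2$ are proportional and have the same roots. But the root \<open>-
  c2' / c2\<close> of $f_2$ is excluded as a root of $f_1$ by the two inequations.\<close>

lemma Im_quadratic_pair_not_identically_zero:
  fixes h1 h1' h2 h2' c1 c1' c2 c2' :: real
  assumes pos: "h1 > 0" "h1' > 0" "h2 > 0" "h2' > 0" "c1 > 0" "c1' > 0" "c2 > 0" "c2' > 0"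
    and ne: "h1 * c2 \<noteq> h1' * c2'" "c1' * c2 \<noteq> c2' * c1"
  obtains u :: complex where
    "Im ((h1 + cnj u * h1') * (h2 + u * h2') * (c1' + cnj u * c1) * (c2' + u * c2)) \<noteq> 0"
proof (rule ccontr)
  assume "\<not> thesis"
  with that have zero:
    "Im ((h1 + cnj u * h1') * (h2 + u * h2') * (c1' + cnj u * c1) * (c2' + u * c2)) = 0" for u :: complex
    by blast
  define a1 b1 g1 a2 b2 g2 where "a1 = h1 * c1'" and "b1 = h1 * c1 + h1' * c1'" and "g1 = h1' * c1"
    and "a2 = h2 * c2'" and "b2 = h2 * c2 + h2' * c2'" and "g2 = h2' * c2"
  note defs = a1_def b1_def g1_def a2_def b2_def g2_def
  have eq: "y * ((a1 * b2 - a2 * b1) + 2 * x * (a1 * g2 - a2 * g1) + (x\<^sup>2 + y\<^sup>2) * (b1 * g2 - b2 * g1)) = 0" for x y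
    using zero[of "Complex x y"] unfolding defs by (simp add: algebra_simps power2_eq_square)
  have m3: "b1 * g2 - b2 * g1 = 0" and m1: "a1 * b2 - a2 * b1 = 0" and m2: "a1 * g2 - a2 * g1 = 0"
    using eq[of 1 0] eq[of 2 0] eq[of 1 1] by simp_all
  define x where "x = - c2' / c2"
  have "a2 * (a1 + b1 * x + g1 * x\<^sup>2) = a1 * (a2 + b2 * x + g2 * x\<^sup>2)"
    using m1 m2 by algebra
  also have "a2 + b2 * x + g2 * x\<^sup>2 = (h2 + x * h2') * (c2' + x * c2)"
    by (simp add: defs algebra_simps power2_eq_square)
  also have "c2' + x * c2 = 0" using pos by (simp add: x_def)
  finally have "a1 + b1 * x + g1 * x\<^sup>2 = 0" using pos by (simp add: a2_def)
  moreover have "a1 + b1 * x + g1 * x\<^sup>2 = (h1 + x * h1') * (c1' + x * c1)"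
    by (simp add: defs algebra_simps power2_eq_square)
  ultimately have "h1 + x * h1' = 0 \<or> c1' + x * c1 = 0" by simp
  then show False using ne pos by (auto simp: x_def field_simps)
qed

lemma coeff_complex_of_real_powers:
  "coeff ([:of_real s, 1:] ^ p * [:1, of_real s:] ^ q :: complex poly) k =
   of_real (coeff ([:s, 1:] ^ p * [:1, s:] ^ q) k)"
proof -
  have mult: "\<forall>k. coeff (P * Q) k = of_real (coeff (P' * Q') k)"
    if "\<forall>k. coeff P k = of_real (coeff P' k)" "\<forall>k. coeff Q k = of_real (coeff Q' k)"
    for P Q :: "complex poly" and P' Q'
    using that by (simp add: coeff_mult)
  have pow: "\<forall>k. coeff (P ^ m) k = of_real (coeff (P' ^ m) k)"
    if "\<forall>k. coeff P k = of_real (coeff P' k)" for P :: "complex poly" and P' m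
  proof (induction m)
    case 0 show ?case by (simp add: coeff_1)
  next
    case (Suc m) show ?case unfolding power_Suc by (rule mult[OF that Suc])
  qed
  have "\<forall>k. coeff [:of_real s, 1:] k = complex_of_real (coeff [:s, 1:] k)"
       "\<forall>k. coeff [:1, of_real s:] k = complex_of_real (coeff [:1, s:] k)"
    by (simp_all add: coeff_pCons split: nat.split)
  from mult[OF pow[OF this(1)] pow[OF this(2)]] show ?thesis by blast
qed

text \<open>Here \<open>m\<close> is the number of reflected factors. The case \<open>m = n\<close> is excluded for
  \<open>k1 + k2 = n\<close> since it is the genuine second solution. For $s = 1$ the reflection does not
  change $z+s$, which makes the coefficients binomial but cannot separate \<open>m < n\<close> from
  \<open>m = n\<close>; every value in $(0,1)$ does, and $1/2$ is taken.\<close>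

definition admissible :: "nat \<Rightarrow> nat \<Rightarrow> nat \<Rightarrow> real \<Rightarrow> nat \<Rightarrow> bool" where
  "admissible n k1 k2 s m \<longleftrightarrow>
     1 \<le> m \<and> m \<le> n \<and> (s = 1 \<and> k1 + k2 \<noteq> n \<or> s = 1 / 2 \<and> k1 + k2 = n \<and> m < n)"

text \<open>The model configuration: \<open>X\<close> has the simple factor \<open>z + u\<close> and the \<open>(n -
  1)\<close>-fold factor \<open>z + s\<close>, and the factor \<open>z + u\<close> together with \<open>m
  - 1\<close> of the others is reflected. With \<open>h\<close> and \<open>c\<close> the positive
  coefficients of the products of the remaining factors, the coefficients of \<open>Y\<close> and
  \<open>X\<close> at \<open>k\<close> are $h_k + \bar u h_{k-1}$ and $c_{k-1} + u c_k$, and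
  \<open>Im_quadratic_pair_not_identically_zero\<close> applies.\<close>

lemma phase_form_model_nonreal:
  assumes k: "1 \<le> k1" "k1 < n" "1 \<le> k2" "k2 < n" "k1 \<noteq> k2"
    and adm: "admissible n k1 k2 s m"
  obtains u where
    "Im (phase_form k1 k2 ([:1, cnj u:] * ([:of_real s, 1:] ^ (n - m) * [:1, of_real s:] ^ (m - 1)))
                          ([:u, 1:] * [:of_real s, 1:] ^ (n - 1))) \<noteq> 0"
proof -
  have s: "s > 0" and m: "1 \<le> m" "m \<le> n" using adm by (auto simp: admissible_def)
  define h where "h = coeff ([:s, 1:] ^ (n - m) * [:1, s:] ^ (m - 1))"
  define c where "c = coeff ([:s, 1:] ^ (n - 1))"
  have hpos: "h k > 0" if "k < n" for k
    unfolding h_def using that m by (intro coeff_two_linear_powers_pos[OF s]) simp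
  have cpos: "c k > 0" if "k < n" for k
    using coeff_two_linear_powers_pos[OF s, of k "n - 1" 0] that by (simp add: c_def)
  have crat: "s * k * c k = (n - k) * c (k - 1)" if "1 \<le> k" "k < n" for k
    using coeff_ratio_linear_power[of k n s] that by (simp add: c_def)
  have hrec: "k1 * h k1 = s * (n - k1) * h (k1 - 1)
     + (n - m) * (1 - s\<^sup>2) * coeff ([:s, 1:] ^ (n - m - 1) * [:1, s:] ^ (m - 1)) (k1 - 1)"
    using coeff_recurrence_two_linear_powers[of k1 "n - m" "m - 1" s] k m
    by (simp add: h_def of_nat_diff algebra_simps)
  \<comment> \<open>Equality would mean $h_{k_1}/h_{k_1-1} = s k_2/(n-k_2)$. For $s = 1$ the left side is $(n-k_1)/k_1$,
    forcing $k_1 + k_2 = n$; for $s = 1/2$ and $k_1 + k_2 = n$ the left side is strictly larger.\<close>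
  have ne1: "h k1 * c k2 \<noteq> h (k1 - 1) * c (k2 - 1)"
  proof
    assume "h k1 * c k2 = h (k1 - 1) * c (k2 - 1)"
    then have "(h k1 * (n - k2)) * c k2 = (n - k2) * c (k2 - 1) * h (k1 - 1)" by simp
    also have "(n - k2) * c (k2 - 1) = s * k2 * c k2" using crat[OF k(3,4)] k by (simp add: of_nat_diff)
    finally have eq: "h k1 * (n - k2) = s * k2 * h (k1 - 1)" using cpos[OF k(4)] by simp
    from adm consider "s = 1" "k1 + k2 \<noteq> n" | "s = 1 / 2" "k1 + k2 = n" "m < n"
      by (auto simp: admissible_def)
    then show False
    proof cases
      case 1
      have "(real k1 * k2) * h (k1 - 1) = ((real n - k1) * (real n - k2)) * h (k1 - 1)"
      proof -
        have "(real k1 * k2) * h (k1 - 1) = k1 * (h k1 * (real n - k2))" using eq 1(1) k by (simp add: of_nat_diff)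
        also have "\<dots> = (k1 * h k1) * (real n - k2)" by simp
        also have "k1 * h k1 = (real n - k1) * h (k1 - 1)" using hrec 1(1) k by (simp add: of_nat_diff)
        finally show ?thesis by (simp add: mult_ac)
      qed
      then have "real k1 * real k2 = (real n - k1) * (real n - k2)" using hpos[of "k1 - 1"] k by fastforce
      then have "real n * (real n - (real k1 + real k2)) = 0" by (simp add: algebra_simps)
      then show False using 1(2) k by (metis eq_iff_diff_eq_0 mult_eq_0_iff of_nat_add of_nat_eq_0_iff of_nat_eq_iff not_less_zero)
    next
      case 2
      have "coeff ([:s, 1:] ^ (n - m - 1) * [:1, s:] ^ (m - 1)) (k1 - 1) > 0"
        using 2 k m by (intro coeff_two_linear_powers_pos[OF s]) simp
      moreover have "1 - s\<^sup>2 > 0" unfolding 2(1) by (simp add: power2_eq_square)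
      ultimately have "(real n - m) * (1 - s\<^sup>2) * coeff ([:s, 1:] ^ (n - m - 1) * [:1, s:] ^ (m - 1)) (k1 - 1) > 0"
        using 2(3) by (intro mult_pos_pos) simp_all
      moreover have n: "n - k2 = k1" "n - k1 = k2" using 2 by auto
      have "k1 * h k1 = s * k2 * h (k1 - 1)" using eq unfolding n by (simp add: mult_ac)
      ultimately show False using hrec m unfolding n by (auto simp: of_nat_diff)
    qed
  qed
  have ne2: "c (k1 - 1) * c k2 \<noteq> c (k2 - 1) * c k1"
  proof
    assume eq: "c (k1 - 1) * c k2 = c (k2 - 1) * c k1"
    have crat1: "s * k1 * c k1 = (real n - k1) * c (k1 - 1)" and crat2: "s * k2 * c k2 = (real n - k2) * c (k2 - 1)"
      using crat k by (simp_all add: of_nat_diff)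
    have "(s * c k1 * c k2) * (real k1 * (real n - k2)) = (s * k1 * c k1) * (real n - k2) * c k2" by simp
    also have "\<dots> = (real n - k1) * (real n - k2) * (c (k1 - 1) * c k2)" unfolding crat1 by simp
    also have "\<dots> = (real n - k1) * c k1 * ((real n - k2) * c (k2 - 1))" unfolding eq by simp
    also have "\<dots> = (s * c k1 * c k2) * (k2 * (real n - k1))" unfolding crat2[symmetric] by simp
    finally have "real k1 * (real n - k2) = k2 * (real n - k1)"
      using s cpos[OF k(2)] cpos[OF k(4)] by simp
    then have "real n * (real k1 - k2) = 0" by (simp add: algebra_simps)
    then show False using k by simp
  qed
  obtain u :: complex where u: "Im ((h k1 + cnj u * h (k1 - 1)) * (h k2 + u * h (k2 - 1)) *
      (c (k1 - 1) + cnj u * c k1) * (c (k2 - 1) + u * c k2)) \<noteq> 0"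
    using Im_quadratic_pair_not_identically_zero[OF _ _ _ _ _ _ _ _ ne1 ne2] hpos cpos k
    by (metis less_imp_diff_less)
  show ?thesis
  proof (rule that)
    have y: "coeff ([:1, cnj u:] * ([:of_real s, 1:] ^ (n - m) * [:1, of_real s:] ^ (m - 1))) k =
       h k + cnj u * h (k - 1)" if "1 \<le> k" for k
      unfolding coeff_linear_mult[OF that] coeff_complex_of_real_powers h_def by simp
    have x: "coeff ([:u, 1:] * [:of_real s, 1:] ^ (n - 1)) k = c (k - 1) + u * c k" if "1 \<le> k" for k
      using coeff_complex_of_real_powers[of s "n - 1" 0]
      unfolding coeff_linear_mult[OF that] by (simp add: c_def)
    show "Im (phase_form k1 k2 ([:1, cnj u:] * ([:of_real s, 1:] ^ (n - m) * [:1, of_real s:] ^ (m - 1)))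
                          ([:u, 1:] * [:of_real s, 1:] ^ (n - 1))) \<noteq> 0"
      unfolding phase_form_def x[OF k(1)] x[OF k(3)] y[OF k(1)] y[OF k(3)] using u by simp
  qed
qed


section \<open>Coefficients depending on parameters\<close>

text \<open>Coefficients of products of linear factors are needed both as continuous functions of parameters and as
  polynomial functions of one real variable. Both classes of functions are closed under ring operations
  and conjugation, which suffices for the membership statements below.\<close>

definition conj_subring :: "('g \<Rightarrow> complex) set \<Rightarrow> bool" where
  "conj_subring F \<longleftrightarrow> (\<forall>c. (\<lambda>_. c) \<in> F) \<and>
     (\<forall>f\<in>F. \<forall>g\<in>F. (\<lambda>x. f x + g x) \<in> F \<and> (\<lambda>x. f x * g x) \<in> F \<and> (\<lambda>x. cnj (f x)) \<in> F)"

lemma conj_subringD: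
  assumes "conj_subring F"
  shows "(\<lambda>_. c) \<in> F"
    and "f \<in> F \<Longrightarrow> g \<in> F \<Longrightarrow> (\<lambda>x. f x + g x) \<in> F"
    and "f \<in> F \<Longrightarrow> g \<in> F \<Longrightarrow> (\<lambda>x. f x * g x) \<in> F"
    and "f \<in> F \<Longrightarrow> (\<lambda>x. cnj (f x)) \<in> F"
  using assms unfolding conj_subring_def by blast+

lemma conj_subring_sum:
  assumes "conj_subring F" "\<And>i. i \<in> A \<Longrightarrow> f i \<in> F"
  shows "(\<lambda>x. \<Sum>i\<in>A. f i x) \<in> F"
  using assms(2) by (induction A rule: infinite_finite_induct)
    (simp_all add: conj_subringD[OF assms(1)])

lemma conj_subring_coeff_mult:
  assumes "conj_subring F" "\<And>i. (\<lambda>x. coeff (p x) i) \<in> F" "\<And>i. (\<lambda>x. coeff (q x) i) \<in> F"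
  shows "(\<lambda>x. coeff (p x * q x) i) \<in> F"
  unfolding coeff_mult
  by (intro conj_subring_sum[OF assms(1)] conj_subringD(3)[OF assms(1)] assms(2,3))

lemma conj_subring_coeff_linear:
  assumes "conj_subring F" "a \<in> F" "b \<in> F"
  shows "(\<lambda>x. coeff [:a x, b x:] i) \<in> F"
proof -
  have "coeff [:p, q:] i = (if i = 0 then p else if i = 1 then q else 0)" for p q :: complex
    by (simp add: coeff_pCons split: nat.split)
  then show ?thesis using assms conj_subringD(1)[OF assms(1), of 0]
    by (cases "i = 0"; cases "i = 1") simp_all
qed

lemma conj_subring_coeff_power:
  assumes "conj_subring F" "\<And>i. (\<lambda>x. coeff (p x) i) \<in> F"
  shows "(\<lambda>x. coeff (p x ^ m) i) \<in> F"
proof (induction m arbitrary: i)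
  case (Suc m)
  then show ?case unfolding power_Suc by (intro conj_subring_coeff_mult assms)
qed (simp add: coeff_1 conj_subringD(1)[OF assms(1)])

lemma conj_subring_coeff_flip_prod:
  assumes "conj_subring F" "finite S" "\<And>j. (\<lambda>x. c x j) \<in> F" "\<And>j. (\<lambda>x. d x j) \<in> F"
  shows "(\<lambda>x. coeff (flip_prod (c x) (d x) S J) i) \<in> F"
  using assms(2)
proof (induction S arbitrary: i rule: finite_induct)
  case (insert j S)
  have "(\<lambda>x. coeff (if j \<in> J then [:cnj (d x j), cnj (c x j):] else [:c x j, d x j:]) i) \<in> F" for i
    using assms by (cases "j \<in> J") (auto intro!: conj_subring_coeff_linear conj_subringD(4))
  then show ?case unfolding flip_prod_insert[OF insert.hyps]
    by (intro conj_subring_coeff_mult assms insert.IH)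
qed (simp add: flip_prod_def coeff_1 conj_subringD(1)[OF assms(1)])

lemma conj_subring_phase_form:
  assumes "conj_subring F" "\<And>i. (\<lambda>x. coeff (Y x) i) \<in> F" "\<And>i. (\<lambda>x. coeff (X x) i) \<in> F"
  shows "(\<lambda>x. phase_form k1 k2 (Y x) (X x)) \<in> F"
  unfolding phase_form_def by (intro conj_subringD[OF assms(1)] assms(2,3))

lemma conj_subring_continuous:
  "conj_subring {f :: 'g::topological_space \<Rightarrow> complex. continuous_on UNIV f}"
  unfolding conj_subring_def by (auto intro!: continuous_intros)

lemma conj_subring_real_poly: "conj_subring {f :: real \<Rightarrow> complex. \<exists>p. \<forall>t. f t = poly p (of_real t)}"
  unfolding conj_subring_def
proof (intro conjI ballI allI; clarify)
  fix c show "\<exists>p. \<forall>t. c = poly p (complex_of_real t)" by (rule exI[of _ "[:c:]"]) simp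
next
  fix f g p q assume "\<forall>t. f t = poly p (complex_of_real t)" "\<forall>t. g t = poly q (complex_of_real t)"
  then show "\<exists>r. \<forall>t. f t + g t = poly r (complex_of_real t)" "\<exists>r. \<forall>t. f t * g t = poly r (complex_of_real t)"
    "\<exists>r. \<forall>t. cnj (f t) = poly r (complex_of_real t)"
    by (auto intro: exI[of _ "p + q"] exI[of _ "p * q"] exI[of _ "map_poly cnj p"])
qed

section \<open>The phase form on an orbit of Moebius substitutions\<close>

text \<open>Linear factors with the common root \<open>- s\<close> for real \<open>s\<close>: up to a constant
  factor the product depends on the number of reflected factors alone.\<close>

lemma flip_prod_proportional:
  fixes \<mu> :: "'i \<Rightarrow> complex" and s :: real
  assumes "finite S" "\<And>j. j \<in> S \<Longrightarrow> \<mu> j \<noteq> 0"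
  obtains \<kappa> where "\<kappa> \<noteq> 0"
    "flip_prod (\<lambda>j. of_real s * \<mu> j) \<mu> S J =
       smult \<kappa> ([:of_real s, 1:] ^ card (S - J) * [:1, of_real s:] ^ card (S \<inter> J))"
proof -
  define \<kappa> where "\<kappa> = (\<Prod>j\<in>S. if j \<in> J then cnj (\<mu> j) else \<mu> j)"
  have "flip_prod (\<lambda>j. of_real s * \<mu> j) \<mu> S J =
    (\<Prod>j\<in>S. smult (if j \<in> J then cnj (\<mu> j) else \<mu> j) (if j \<in> J then [:1, of_real s:] else [:of_real s, 1:]))"
    unfolding flip_prod_def by (intro prod.cong) (auto simp: mult_ac)
  also have "\<dots> = smult \<kappa> (\<Prod>j\<in>S. if j \<in> J then [:1, of_real s:] else [:of_real s, 1:])"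
    by (simp add: \<kappa>_def prod_smult)
  also have "(\<Prod>j\<in>S. if j \<in> J then [:1, of_real s:] else [:of_real s, 1:]) =
     [:1, of_real s:] ^ card (S \<inter> J) * [:of_real s, 1 :: complex:] ^ card (S - J)"
    using assms(1) by (simp add: prod.If_cases Diff_eq)
  finally show ?thesis using assms by (intro that[of \<kappa>]) (auto simp: \<kappa>_def mult_ac)
qed

text \<open>At $(a,b) = (\beta_i + t, s\beta_i + tu)$ with real \<open>t\<close>, the \<open>i\<close>-th factor is
  $t(z+u)$ and the \<open>j\<close>-th one is $(\beta_i-\beta_j)(z+s) + t(z+u)$. After division by the
  power of \<open>t\<close> coming from the \<open>i\<close>-th factor, the limit $t \to 0$ is a nonzero
  multiple of the model configuration. The \<open>i\<close>-th factor has to be a reflected one, and all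
  the other roots have to be different from it.\<close>

lemma phase_form_nonreal_on_orbit:
  fixes \<beta> :: "nat \<Rightarrow> complex" and s :: real
  assumes k: "1 \<le> k1" "k1 < n" "1 \<le> k2" "k2 < n" "k1 \<noteq> k2"
    and inj: "inj_on \<beta> {..<n}" and J: "J \<subseteq> {..<n}" and adm: "admissible n k1 k2 s (card J)"
  obtains a b where "Im (phase_form k1 k2
     (flip_prod (\<lambda>j. b - of_real s * \<beta> j) (\<lambda>j. a - \<beta> j) {..<n} J)
     (flip_prod (\<lambda>j. b - of_real s * \<beta> j) (\<lambda>j. a - \<beta> j) {..<n} {})) \<noteq> 0"
proof -
  have "card J \<noteq> 0" using adm by (auto simp: admissible_def)
  then obtain i where i: "i \<in> J" by fastforce
  have iN: "i < n" using i J by auto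
  define S where "S = {..<n} - {i}"
  have S: "finite S" "i \<notin> S" "{..<n} = insert i S" using iN by (auto simp: S_def)
  obtain u where u: "Im (phase_form k1 k2
        ([:1, cnj u:] * ([:of_real s, 1:] ^ (n - card J) * [:1, of_real s:] ^ (card J - 1)))
        ([:u, 1:] * [:of_real s, 1:] ^ (n - 1))) \<noteq> 0"
    by (rule phase_form_model_nonreal[OF k adm])
  define \<mu> where "\<mu> = (\<lambda>j. \<beta> i - \<beta> j)"
  have \<mu>: "\<mu> j \<noteq> 0" if "j \<in> S" for j
    using inj that iN by (auto simp: \<mu>_def S_def inj_on_def)
  define c d where "c = (\<lambda>(t::real) j. of_real s * \<mu> j + of_real t * u)" and "d = (\<lambda>(t::real) j. \<mu> j + of_real t)"
  define R where "R = (\<lambda>J t. flip_prod (c t) (d t) S J)"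
  define G where "G = (\<lambda>t. phase_form k1 k2 ([:1, cnj u:] * R J t) ([:u, 1:] * R {} t))"
  have cont: "continuous_on UNIV G"
  proof -
    note cs = conj_subring_continuous[where 'g=real]
    have "(\<lambda>t. coeff (R J t) i) \<in> {f. continuous_on UNIV f}" for J i
      unfolding R_def by (rule conj_subring_coeff_flip_prod[OF cs S(1)])
        (auto simp: c_def d_def intro!: continuous_intros)
    then have "G \<in> {f. continuous_on UNIV f}" unfolding G_def
      by (intro conj_subring_phase_form[OF cs] conj_subring_coeff_mult[OF cs]) auto
    then show ?thesis by simp
  qed
  have G0: "Im (G 0) \<noteq> 0"
  proof -
    have R0: "R J 0 = flip_prod (\<lambda>j. of_real s * \<mu> j) \<mu> S J" for J
      by (simp add: R_def c_def d_def)
    obtain \<kappa> where \<kappa>: "\<kappa> \<noteq> 0" "R J 0 = smult \<kappa> ([:of_real s, 1:] ^ card (S - J) * [:1, of_real s:] ^ card (S \<inter> J))"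
      unfolding R0 by (rule flip_prod_proportional[OF S(1) \<mu>])
    obtain \<kappa>' where \<kappa>': "\<kappa>' \<noteq> 0" "R {} 0 = smult \<kappa>' ([:of_real s, 1:] ^ card (S - {}) * [:1, of_real s:] ^ card (S \<inter> {}))"
      unfolding R0 by (rule flip_prod_proportional[OF S(1) \<mu>])
    have "S - J = {..<n} - J" "S \<inter> J = J - {i}" "card S = n - 1" using i J iN by (auto simp: S_def)
    then have card: "card (S - J) = n - card J" "card (S \<inter> J) = card J - 1" "card S = n - 1"
      using i J finite_subset[OF J] by (auto simp: card_Diff_subset)
    have "G 0 = of_real ((cmod \<kappa>)\<^sup>2 * (cmod \<kappa>')\<^sup>2) * phase_form k1 k2
        ([:1, cnj u:] * ([:of_real s, 1:] ^ (n - card J) * [:1, of_real s:] ^ (card J - 1)))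
        ([:u, 1:] * [:of_real s, 1:] ^ (n - 1))"
      unfolding G_def \<kappa>(2) \<kappa>'(2) card mult_smult_right phase_form_smult by (simp add: card)
    then show ?thesis using u \<kappa>(1) \<kappa>'(1) by simp
  qed
  have "isCont (\<lambda>t. Im (G t)) 0"
    using cont by (auto simp: continuous_on_eq_continuous_at intro!: isCont_Im)
  then have "((\<lambda>t. Im (G t)) \<longlongrightarrow> Im (G 0)) (at 0)" by (simp add: isCont_def)
  then have "eventually (\<lambda>t. Im (G t) \<noteq> 0) (at (0::real))"
    using G0 by (rule tendsto_imp_eventually_ne)
  then obtain e where e: "e > 0" "\<And>t. t \<noteq> 0 \<Longrightarrow> dist t 0 < e \<Longrightarrow> Im (G t) \<noteq> 0"
    unfolding eventually_at by auto
  define t where "t = e / 2"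
  have t: "Im (G t) \<noteq> 0" "t \<noteq> 0" using e(1) e(2)[of t] by (auto simp: t_def)
  show ?thesis
  proof (rule that)
    have Y: "flip_prod (\<lambda>j. (of_real s * \<beta> i + of_real t * u) - of_real s * \<beta> j) (\<lambda>j. (\<beta> i + of_real t) - \<beta> j) {..<n} K =
       smult (of_real t) ((if i \<in> K then [:1, cnj u:] else [:u, 1:]) * R K t)" for K
    proof -
      have "(\<lambda>j. (of_real s * \<beta> i + of_real t * u) - of_real s * \<beta> j) = c t"
        "(\<lambda>j. (\<beta> i + of_real t) - \<beta> j) = d t"
        by (auto simp: c_def d_def \<mu>_def algebra_simps)
      moreover have "c t i = of_real t * u" "d t i = of_real t" by (simp_all add: c_def d_def \<mu>_def)
      ultimately show ?thesis
        unfolding S(3) flip_prod_insert[OF S(1,2)] R_def by (auto simp: smult_add_right)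
    qed
    show "Im (phase_form k1 k2
      (flip_prod (\<lambda>j. (of_real s * \<beta> i + of_real t * u) - of_real s * \<beta> j) (\<lambda>j. (\<beta> i + of_real t) - \<beta> j) {..<n} J)
      (flip_prod (\<lambda>j. (of_real s * \<beta> i + of_real t * u) - of_real s * \<beta> j) (\<lambda>j. (\<beta> i + of_real t) - \<beta> j) {..<n} {})) \<noteq> 0"
      unfolding Y phase_form_smult using t i by (simp add: G_def)
  qed
qed

section \<open>Null sets of Lebesgue measure on finite products\<close>

abbreviation lborel_pow :: "nat \<Rightarrow> (nat \<Rightarrow> real) measure" where
  "lborel_pow d \<equiv> (\<Pi>\<^sub>M k\<in>{..<d}. (lborel :: real measure))"

interpretation lborel_prod: product_sigma_finite "\<lambda>_::nat. lborel :: real measure"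
  by standard

lemma sigma_finite_lborel_pow: "sigma_finite_measure (lborel_pow d)"
  by (rule lborel_prod.sigma_finite) simp

definition vadd :: "nat \<Rightarrow> (nat \<Rightarrow> real) \<Rightarrow> (nat \<Rightarrow> real) \<Rightarrow> nat \<Rightarrow> real" where
  "vadd d x v = (\<lambda>i\<in>{..<d}. x i + v i)"

lemma measurable_vadd:
  "(\<lambda>(x, v). vadd d x v) \<in> measurable (lborel_pow d \<Otimes>\<^sub>M lborel_pow d) (lborel_pow d)"
  unfolding vadd_def case_prod_beta
  by (rule measurable_restrict) measurable

lemma measurable_vadd_left: "(\<lambda>x. vadd d x v) \<in> measurable (lborel_pow d) (lborel_pow d)"
  unfolding vadd_def by (rule measurable_restrict) measurable

lemma distr_vadd: "distr (lborel_pow d) (lborel_pow d) (\<lambda>x. vadd d x v) = lborel_pow d"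
proof (rule lborel_prod.PiM_eqI)
  fix A :: "nat \<Rightarrow> real set" assume A: "\<And>i. i \<in> {..<d} \<Longrightarrow> A i \<in> sets lborel"
  have A': "(\<lambda>y. v i + y) -` A i \<in> sets lborel" if "i < d" for i
  proof -
    have "A i \<in> sets borel" using A[of i] that by simp
    then show ?thesis using measurable_sets[of "\<lambda>y. v i + y" borel borel "A i"] by simp
  qed
  have "emeasure (distr (lborel_pow d) (lborel_pow d) (\<lambda>x. vadd d x v)) (Pi\<^sub>E {..<d} A) =
      emeasure (lborel_pow d) ((\<lambda>x. vadd d x v) -` Pi\<^sub>E {..<d} A \<inter> space (lborel_pow d))"
    by (rule emeasure_distr[OF measurable_vadd_left]) (rule sets_PiM_I_finite, use A in auto)
  also have "(\<lambda>x. vadd d x v) -` Pi\<^sub>E {..<d} A \<inter> space (lborel_pow d) = Pi\<^sub>E {..<d} (\<lambda>i. (\<lambda>y. v i + y) -` A i)"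
    by (auto simp: vadd_def space_PiM PiE_iff add.commute)
  also have "emeasure (lborel_pow d) \<dots> = (\<Prod>i<d. emeasure lborel ((\<lambda>y. v i + y) -` A i))"
    using A' by (intro lborel_prod.emeasure_PiM) auto
  also have "\<dots> = (\<Prod>i<d. emeasure lborel (A i))"
  proof (intro prod.cong refl)
    fix i assume "i \<in> {..<d}"
    then have "A i \<in> sets borel" using A[of i] by simp
    then have "emeasure (distr lborel borel ((+) (v i))) (A i) = emeasure lborel ((\<lambda>y. v i + y) -` A i)"
      by (subst emeasure_distr) auto
    then show "emeasure lborel ((\<lambda>y. v i + y) -` A i) = emeasure lborel (A i)"
      by (simp add: lborel_distr_plus)
  qed
  finally show "emeasure (distr (lborel_pow d) (lborel_pow d) (\<lambda>x. vadd d x v)) (Pi\<^sub>E {..<d} A) =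
      (\<Prod>i<d. emeasure lborel (A i))" .
qed simp_all

lemma AE_vadd_iff:
  assumes "B \<in> sets (lborel_pow d)"
  shows "(AE x in lborel_pow d. vadd d x v \<notin> B) \<longleftrightarrow> (AE x in lborel_pow d. x \<notin> B)"
proof -
  have "{x \<in> space (lborel_pow d). x \<notin> B} = space (lborel_pow d) - B" by auto
  then have "{x \<in> space (lborel_pow d). x \<notin> B} \<in> sets (lborel_pow d)" using assms by simp
  from AE_distr_iff[OF measurable_vadd_left this, of v] show ?thesis
    unfolding distr_vadd by simp
qed

lemma emeasure_lborel_pow_nonzero: "emeasure (lborel_pow d) (space (lborel_pow d)) \<noteq> 0"
proof -
  have "emeasure (lborel_pow d) (Pi\<^sub>E {..<d} (\<lambda>_. {0..1})) = (\<Prod>i<d. emeasure lborel {0..1::real})"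
    by (rule lborel_prod.emeasure_PiM) auto
  also have "\<dots> = 1" by simp
  finally have "1 \<le> emeasure (lborel_pow d) (space (lborel_pow d))"
    by (metis emeasure_space)
  then show ?thesis by auto
qed

text \<open>Fubini in the form used throughout: two almost-everywhere quantifiers commute on the complement of a
  measurable set.\<close>

lemma AE_swap:
  fixes L :: "'g measure" and M :: "'m measure"
  assumes "sigma_finite_measure L" "sigma_finite_measure M"
    and \<Phi>: "(\<lambda>(g, x). \<Phi> g x) \<in> measurable (L \<Otimes>\<^sub>M M) N" and B: "B \<in> sets N"
    and ae: "AE x in M. AE g in L. \<Phi> g x \<notin> B"
  shows "AE g in L. AE x in M. \<Phi> g x \<notin> B"
proof -
  interpret pair_sigma_finite L M using assms(1,2) by (rule pair_sigma_finite.intro)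
  have "{z \<in> space (L \<Otimes>\<^sub>M M). \<Phi> (fst z) (snd z) \<notin> B} =
     space (L \<Otimes>\<^sub>M M) - (\<lambda>(g, x). \<Phi> g x) -` B \<inter> space (L \<Otimes>\<^sub>M M)"
    by auto
  also have "\<dots> \<in> sets (L \<Otimes>\<^sub>M M)" using measurable_sets[OF \<Phi> B] by blast
  finally show ?thesis using ae by (subst AE_commute) auto
qed

lemma AE_exists:
  assumes "emeasure M (space M) \<noteq> 0" "AE x in M. P x"
  obtains x where "x \<in> space M" "P x"
proof -
  have nb: "ae_filter M \<noteq> bot" using assms(1) by (simp add: ae_filter_eq_bot_iff)
  have "AE x in M. x \<in> space M \<and> P x" using assms(2) AE_space by eventually_elim simp
  then have "\<exists>x. x \<in> space M \<and> P x" by (rule eventually_happens'[OF nb])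
  then show ?thesis using that by blast
qed

text \<open>By surjectivity and translation invariance, for every \<open>y\<close> the point \<open>T x + y\<close>
  avoids \<open>B\<close> for almost every \<open>x\<close>. Exchanging the quantifiers gives one
  \<open>x\<close> such that \<open>T x + y\<close> avoids \<open>B\<close> for almost every
  \<open>y\<close>, and \<open>B\<close> is a translate of a null set.\<close>

lemma AE_surj_additive:
  fixes T :: "(nat \<Rightarrow> real) \<Rightarrow> nat \<Rightarrow> real"
  assumes T: "T \<in> measurable (lborel_pow d) (lborel_pow d)"
    and add: "\<And>x v. T (vadd d x v) = vadd d (T x) (T v)"
    and surj: "\<And>y. y \<in> space (lborel_pow d) \<Longrightarrow> \<exists>x. T x = y"
    and B: "B \<in> sets (lborel_pow d)"
    and ae: "AE x in lborel_pow d. T x \<notin> B"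
  shows "AE x in lborel_pow d. x \<notin> B"
proof -
  let ?M = "lborel_pow d"
  have TB: "T -` B \<inter> space ?M \<in> sets ?M" using T B by (rule measurable_sets)
  have TB_iff: "(AE x in ?M. f x \<notin> T -` B \<inter> space ?M) \<longleftrightarrow> (AE x in ?M. T (f x) \<notin> B)"
    if "f \<in> measurable ?M ?M" for f
    using measurable_space[OF that] by (intro AE_cong) auto
  have shift: "AE x in ?M. vadd d (T x) y \<notin> B" if y: "y \<in> space ?M" for y
  proof -
    obtain v where v: "T v = y" using surj[OF y] by blast
    have "AE x in ?M. x \<notin> T -` B \<inter> space ?M" using ae by eventually_elim simp
    then have "AE x in ?M. vadd d x v \<notin> T -` B \<inter> space ?M" by (simp only: AE_vadd_iff[OF TB])
    then show ?thesis by (simp only: TB_iff[OF measurable_vadd_left] add v)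
  qed
  have "(\<lambda>(x, y). vadd d (T x) y) \<in> measurable (?M \<Otimes>\<^sub>M ?M) ?M"
  proof -
    note T[measurable]
    have "(\<lambda>z. (T (fst z), snd z)) \<in> measurable (?M \<Otimes>\<^sub>M ?M) (?M \<Otimes>\<^sub>M ?M)"
      by measurable
    from measurable_compose[OF this measurable_vadd] show ?thesis by (simp add: case_prod_beta)
  qed
  moreover have "AE y in ?M. AE x in ?M. vadd d (T x) y \<notin> B"
    using AE_space by eventually_elim (rule shift)
  ultimately have "AE x in ?M. AE y in ?M. vadd d (T x) y \<notin> B"
    by (rule AE_swap[OF sigma_finite_lborel_pow sigma_finite_lborel_pow _ B])
  then obtain x where "AE y in ?M. vadd d (T x) y \<notin> B"
    by (rule AE_exists[OF emeasure_lborel_pow_nonzero])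
  then have "AE y in ?M. vadd d y (T x) \<notin> B" by (simp add: vadd_def add.commute)
  then show ?thesis by (simp only: AE_vadd_iff[OF B])
qed

text \<open>A nonzero polynomial has a null set of zeros. Seen from a point \<open>p0\<close> outside the zero set,
  every ray meets it in finitely many points. By Fubini, the zero set scaled by almost every factor about
  \<open>p0\<close> is null, and hence the zero set itself.\<close>

lemma AE_lborel_nonzero_of_poly_on_rays:
  fixes f :: "'a::euclidean_space \<Rightarrow> complex"
  assumes cont: "continuous_on UNIV f" and p0: "f p0 \<noteq> 0"
    and ray: "\<And>x. \<exists>p. \<forall>t::real. f (p0 + t *\<^sub>R x) = poly p (of_real t)"
  shows "AE x in lborel. f x \<noteq> 0"
proof -
  have f: "f \<in> borel_measurable borel" using cont by (rule borel_measurable_continuous_onI)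
  have "AE r in (lborel :: real measure). f (p0 + r *\<^sub>R x) \<notin> {0}" for x
  proof -
    obtain p where p: "\<And>t::real. f (p0 + t *\<^sub>R x) = poly p (of_real t)" using ray by blast
    have "poly p 0 \<noteq> 0" using p[of 0] p0 by simp
    then have "p \<noteq> 0" by auto
    then have "finite {z. poly p z = 0}" by (rule poly_roots_finite)
    then have "finite ((of_real :: real \<Rightarrow> complex) -` {z. poly p z = 0})"
      by (rule finite_vimageI) (simp add: inj_of_real)
    then have "of_real -` {z. poly p z = 0} \<in> null_sets (lborel :: real measure)"
      by (rule finite_imp_null_set_lborel)
    then show ?thesis by (rule AE_I') (auto simp: p)
  qed
  then have "AE x in (lborel :: 'a measure). AE r in (lborel :: real measure). f (p0 + r *\<^sub>R x) \<notin> {0}"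
    by (intro always_eventually) blast
  note ae = this
  have "(\<lambda>(r, x). f (p0 + r *\<^sub>R x)) \<in> measurable (lborel \<Otimes>\<^sub>M lborel) borel"
  proof -
    have "(\<lambda>z. p0 + fst z *\<^sub>R snd z) \<in> measurable (lborel \<Otimes>\<^sub>M lborel) borel" by measurable
    from measurable_compose[OF this f] show ?thesis by (simp add: case_prod_beta)
  qed
  then have "AE r in lborel. AE x in lborel. f (p0 + r *\<^sub>R x) \<notin> {0}"
    by (rule AE_swap[OF lborel.sigma_finite_measure_axioms lborel.sigma_finite_measure_axioms _ _ ae]) simp
  moreover have "AE r in lborel. r \<noteq> (0::real)"
    using AE_lborel_singleton[of "0::real"] .
  ultimately have "AE r in lborel. r \<noteq> (0::real) \<and> (AE x in lborel. f (p0 + r *\<^sub>R x) \<notin> {0})"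
    by eventually_elim simp
  then obtain r :: real where r: "r \<noteq> 0" "AE x in lborel. f (p0 + r *\<^sub>R x) \<notin> {0}"
    by (rule AE_exists[rotated]) (blast, simp)
  have set: "{x \<in> space borel. f x \<noteq> 0} \<in> sets borel"
    using measurable_sets[OF f, of "- {0}"] by (simp add: vimage_def)
  have meas: "(\<lambda>x. p0 + r *\<^sub>R x) \<in> measurable lborel borel" by simp
  have "AE x in distr lborel borel (\<lambda>x. p0 + r *\<^sub>R x). f x \<noteq> 0"
    using r(2) unfolding AE_distr_iff[OF meas set] by simp
  then have "AE x in density (distr lborel borel (\<lambda>x. p0 + r *\<^sub>R x)) (\<lambda>_. ennreal (\<bar>r\<bar> ^ DIM('a))). f x \<noteq> 0"
    unfolding AE_density[OF borel_measurable_const] by eventually_elim simp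
  then show ?thesis by (subst lborel_affine[OF r(1), of p0])
qed

text \<open>Transports the extensional functions on \<open>{..<d}\<close> into the topological space of all real
  sequences, where compactness arguments are available.\<close>

definition zero_ext :: "nat \<Rightarrow> (nat \<Rightarrow> real) \<Rightarrow> nat \<Rightarrow> real" where
  "zero_ext d w = (\<lambda>i. if i < d then w i else 0)"

lemma measurable_zero_ext: "zero_ext d \<in> measurable (lborel_pow d) borel"
proof -
  have "(\<lambda>w i. if i < d then w i else 0) \<in> measurable (lborel_pow d) (Pi\<^sub>M UNIV (\<lambda>i::nat. borel :: real measure))"
  proof (rule measurable_PiM_single')
    fix i
    show "(\<lambda>w. if i < d then w i else 0) \<in> borel_measurable (lborel_pow d)"
      by (cases "i < d") auto
  qed auto
  then show ?thesis
    unfolding zero_ext_def[abs_def] using measurable_cong_sets[OF refl sets_PiM_equal_borel] by blast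
qed

lemma compact_bounded_sequences: "compact {w :: nat \<Rightarrow> real. \<forall>i. \<bar>w i\<bar> \<le> b i}"
proof -
  have "compactin (product_topology (\<lambda>_::nat. euclidean :: real topology) UNIV) (Pi\<^sub>E UNIV (\<lambda>i. {- b i..b i}))"
    by (simp add: compactin_PiE)
  moreover have "Pi\<^sub>E UNIV (\<lambda>i. {- b i..b i}) = {w :: nat \<Rightarrow> real. \<forall>i. \<bar>w i\<bar> \<le> b i}"
    by (auto simp: PiE_iff abs_le_iff minus_le_iff)
  ultimately show ?thesis by (simp add: euclidean_product_topology)
qed

text \<open>The projection of a compact set is compact, and a closed set of pairs of sequences supported in fixed
  finite sets is a countable union of compact sets; so its projection is an F-sigma set. This gives the
  measurability of sets defined by an existential quantifier over polynomials.\<close>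

lemma sets_projection_of_closed:
  fixes C :: "nat \<Rightarrow> ((nat \<Rightarrow> real) \<times> (nat \<Rightarrow> real)) set"
  assumes "\<And>r. closed (C r)"
  shows "{w \<in> space (lborel_pow d). \<exists>r \<eta>. (\<forall>i\<ge>e. \<eta> i = 0) \<and> (zero_ext d w, \<eta>) \<in> C r} \<in> sets (lborel_pow d)"
proof -
  define cube where "cube e R = {w :: nat \<Rightarrow> real. \<forall>i. \<bar>w i\<bar> \<le> (if i < e then real R else 0)}" for e R
  define K where "K r R = fst ` (cube d R \<times> cube e R \<inter> C r)" for r R
  have "closed (K r R)" for r R
  proof -
    have "compact (cube m R)" for m unfolding cube_def by (rule compact_bounded_sequences)
    then have "compact (cube d R \<times> cube e R \<inter> C r)"
      using assms[of r] by (intro compact_Int_closed compact_Times)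
    then show ?thesis unfolding K_def
      by (intro compact_imp_closed compact_continuous_image continuous_on_fst continuous_on_id)
  qed
  then have "(\<Union>r. \<Union>R. K r R) \<in> sets borel" by (intro sets.countable_UN) auto
  then have "zero_ext d -` (\<Union>r. \<Union>R. K r R) \<inter> space (lborel_pow d) \<in> sets (lborel_pow d)"
    by (rule measurable_sets[OF measurable_zero_ext])
  also have "zero_ext d -` (\<Union>r. \<Union>R. K r R) \<inter> space (lborel_pow d) =
    {w \<in> space (lborel_pow d). \<exists>r \<eta>. (\<forall>i\<ge>e. \<eta> i = 0) \<and> (zero_ext d w, \<eta>) \<in> C r}" (is "?L = ?R")
  proof
    show "?L \<subseteq> ?R"
    proof
      fix w assume "w \<in> ?L"
      then obtain r R \<eta> where w: "w \<in> space (lborel_pow d)" "\<eta> \<in> cube e R" "(zero_ext d w, \<eta>) \<in> C r"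
        by (auto simp: K_def)
      have "\<eta> i = 0" if "i \<ge> e" for i
        using w(2) that unfolding cube_def by (auto dest!: spec[of _ i])
      then show "w \<in> ?R" using w by blast
    qed
    show "?R \<subseteq> ?L"
    proof
      fix w assume "w \<in> ?R"
      then obtain r \<eta> where w: "w \<in> space (lborel_pow d)" and \<eta>: "\<forall>i\<ge>e. \<eta> i = 0" "(zero_ext d w, \<eta>) \<in> C r"
        by auto
      have bd: "\<exists>R. x \<in> cube m R" if "\<forall>i\<ge>m. x i = 0" for m x
      proof -
        obtain R :: nat where "(\<Sum>i<m. \<bar>x i\<bar>) \<le> R" using real_arch_simple by blast
        moreover have "\<bar>x i\<bar> \<le> (\<Sum>i<m. \<bar>x i\<bar>)" if "i < m" for i
          using that by (intro member_le_sum) auto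
        ultimately have "\<bar>x i\<bar> \<le> (if i < m then real R else 0)" for i
          using that[rule_format, of i] by (cases "i < m") (force, simp)
        then show ?thesis unfolding cube_def by blast
      qed
      have mono: "cube m R \<subseteq> cube m R'" if "R \<le> R'" for m R R'
      proof
        fix x assume x: "x \<in> cube m R"
        have "\<bar>x i\<bar> \<le> (if i < m then real R' else 0)" for i
        proof -
          have "\<bar>x i\<bar> \<le> (if i < m then real R else 0)" using x by (simp add: cube_def)
          with that show ?thesis by (cases "i < m") auto
        qed
        then show "x \<in> cube m R'" by (simp add: cube_def)
      qed
      obtain R1 R2 where "zero_ext d w \<in> cube d R1" "\<eta> \<in> cube e R2"
      proof -
        have "\<forall>i\<ge>d. zero_ext d w i = 0" by (simp add: zero_ext_def)
        then obtain R1 where "zero_ext d w \<in> cube d R1" using bd by blast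
        moreover obtain R2 where "\<eta> \<in> cube e R2" using bd[OF \<eta>(1)] by blast
        ultimately show ?thesis by (rule that)
      qed
      then have "(zero_ext d w, \<eta>) \<in> cube d (max R1 R2) \<times> cube e (max R1 R2) \<inter> C r"
        using mono[of R1 "max R1 R2" d] mono[of R2 "max R1 R2" e] \<eta>(2) by auto
      then have "zero_ext d w \<in> K r (max R1 R2)" unfolding K_def by (rule image_eqI[rotated]) simp
      then show "w \<in> ?L" using w by auto
    qed
  qed
  finally show ?thesis .
qed

section \<open>Polynomials as coordinate vectors\<close>

definition coord :: "(nat \<Rightarrow> real) \<Rightarrow> nat \<Rightarrow> complex" where
  "coord w k = Complex (w (2 * k)) (w (2 * k + 1))"

definition vec_poly :: "nat \<Rightarrow> (nat \<Rightarrow> real) \<Rightarrow> complex poly" where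
  "vec_poly n w = (\<Sum>k\<le>n. monom (coord w k) k)"

definition poly_vec :: "nat \<Rightarrow> complex poly \<Rightarrow> nat \<Rightarrow> real" where
  "poly_vec n p = (\<lambda>i\<in>{..<2 * Suc n}. if even i then Re (coeff p (i div 2)) else Im (coeff p (i div 2)))"

lemma coeff_vec_poly: "coeff (vec_poly n w) k = (if k \<le> n then coord w k else 0)"
  by (simp add: vec_poly_def coeff_sum)

lemma degree_vec_poly: "degree (vec_poly n w) \<le> n"
  by (rule degree_le) (simp add: coeff_vec_poly)

lemma coord_poly_vec: "k \<le> n \<Longrightarrow> coord (poly_vec n p) k = coeff p k"
  by (simp add: coord_def poly_vec_def)

lemma vec_poly_poly_vec: "degree p \<le> n \<Longrightarrow> vec_poly n (poly_vec n p) = p"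
  by (rule poly_eqI) (auto simp: coeff_vec_poly coord_poly_vec coeff_eq_0)

lemma poly_vec_vec_poly:
  assumes "w \<in> space (lborel_pow (2 * Suc n))"
  shows "poly_vec n (vec_poly n w) = w"
proof
  fix i
  show "poly_vec n (vec_poly n w) i = w i"
  proof (cases "i < 2 * Suc n")
    case True
    then have "i div 2 \<le> n" by simp
    moreover have "2 * (i div 2) = i" if "even i" using that by simp
    moreover have "2 * (i div 2) + 1 = i" if "odd i" using that by simp
    ultimately show ?thesis using True by (auto simp: poly_vec_def coeff_vec_poly coord_def)
  next
    case False
    then show ?thesis using assms by (auto simp: poly_vec_def space_PiM PiE_iff extensional_def)
  qed
qed

lemma vec_poly_zero_ext: "vec_poly n (zero_ext (2 * Suc n) w) = vec_poly n w"
  by (simp add: vec_poly_def coord_def zero_ext_def)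

lemma vec_poly_vadd: "vec_poly n (vadd (2 * Suc n) x v) = vec_poly n x + vec_poly n v"
  by (rule poly_eqI) (simp add: coeff_vec_poly coord_def vadd_def complex_eq_iff)

lemma poly_vec_add: "poly_vec n (p + q) = vadd (2 * Suc n) (poly_vec n p) (poly_vec n q)"
  by (auto simp: poly_vec_def vadd_def)

lemma measurable_poly_vec:
  assumes "\<And>k. (\<lambda>z. coeff (f z) k) \<in> borel_measurable L"
  shows "(\<lambda>z. poly_vec n (f z)) \<in> measurable L (lborel_pow (2 * Suc n))"
  unfolding poly_vec_def
proof (rule measurable_restrict)
  fix i
  have "(\<lambda>z. Re (coeff (f z) (i div 2))) \<in> borel_measurable L" "(\<lambda>z. Im (coeff (f z) (i div 2))) \<in> borel_measurable L"
    using assms by (auto intro: borel_measurable_Re borel_measurable_Im measurable_compose)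
  then show "(\<lambda>z. if even i then Re (coeff (f z) (i div 2)) else Im (coeff (f z) (i div 2))) \<in> measurable L lborel"
    by (cases "even i") simp_all
qed

lemma measurable_coord:
  assumes "k \<le> n"
  shows "(\<lambda>w. coord w k) \<in> borel_measurable (lborel_pow (2 * Suc n))"
proof -
  have "(\<lambda>w. w i) \<in> borel_measurable (lborel_pow (2 * Suc n))" if "i < 2 * Suc n" for i
    using measurable_component_singleton[of i "{..<2 * Suc n}" "\<lambda>_. lborel :: real measure"] that by simp
  from this[of "2 * k"] this[of "2 * k + 1"] show ?thesis
    unfolding coord_def Complex_eq using assms by (simp add: borel_measurable_add)
qed

text \<open>To show that a set is null it is enough that almost every translate along one complex direction avoids
  it, from almost every starting point: Fubini exchanges the two and translation invariance removes the
  translation.\<close>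

lemma AE_of_perturbation:
  assumes B: "B \<in> sets (lborel_pow (2 * Suc n))"
    and ae: "AE w in lborel_pow (2 * Suc n). AE g in (lborel :: complex measure).
               vadd (2 * Suc n) w (poly_vec n (smult g p)) \<notin> B"
  shows "AE w in lborel_pow (2 * Suc n). w \<notin> B"
proof -
  let ?M = "lborel_pow (2 * Suc n)"
  have pv: "(\<lambda>g. poly_vec n (smult g p)) \<in> measurable lborel ?M"
    by (rule measurable_poly_vec) simp
  have "(\<lambda>z. (snd z, poly_vec n (smult (fst z) p))) \<in> measurable (lborel \<Otimes>\<^sub>M ?M) (?M \<Otimes>\<^sub>M ?M)"
    using pv by measurable
  from measurable_compose[OF this measurable_vadd]
  have "(\<lambda>(g, w). vadd (2 * Suc n) w (poly_vec n (smult g p))) \<in> measurable (lborel \<Otimes>\<^sub>M ?M) ?M"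
    by (simp add: case_prod_beta)
  from AE_swap[OF lborel.sigma_finite_measure_axioms sigma_finite_lborel_pow this B ae]
  obtain g where "AE w in ?M. vadd (2 * Suc n) w (poly_vec n (smult g p)) \<notin> B"
    by (rule AE_exists[rotated]) simp_all
  then show ?thesis by (simp only: AE_vadd_iff[OF B])
qed

lemma AE_lborel_notin_finite:
  "finite A \<Longrightarrow> AE x in (lborel :: 'a::euclidean_space measure). x \<notin> A"
  using AE_not_in[OF finite_imp_null_set_lborel] .

lemma AE_coord_nonzero:
  assumes "k \<le> n"
  shows "AE w in lborel_pow (2 * Suc n). coord w k \<noteq> 0"
proof -
  let ?M = "lborel_pow (2 * Suc n)"
  define B where "B = (\<lambda>w. coord w k) -` {0} \<inter> space ?M"
  have B: "B \<in> sets ?M" unfolding B_def by (rule measurable_sets[OF measurable_coord[OF assms]]) simp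
  have "AE g in (lborel :: complex measure). vadd (2 * Suc n) w (poly_vec n (smult g (monom 1 k))) \<notin> B" for w
  proof -
    have "coord (vadd (2 * Suc n) w (poly_vec n (smult g (monom 1 k)))) k = coord w k + g" for g
      using assms coeff_vec_poly[of n "vadd (2 * Suc n) w (poly_vec n (smult g (monom 1 k)))" k]
      unfolding vec_poly_vadd by (simp add: coeff_vec_poly coord_poly_vec)
    then have eq: "vadd (2 * Suc n) w (poly_vec n (smult g (monom 1 k))) \<in> B \<Longrightarrow> g \<in> {- coord w k}" for g
      by (auto simp: B_def add_eq_0_iff)
    have "AE g in (lborel :: complex measure). g \<notin> {- coord w k}"
      by (rule AE_lborel_notin_finite) simp
    then show ?thesis by eventually_elim (use eq in blast)
  qed
  then have "AE w in ?M. w \<notin> B" by (intro AE_of_perturbation[OF B]) (rule always_eventually, blast)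
  with AE_space show ?thesis by eventually_elim (auto simp: B_def)
qed

lemma continuous_coeff_vec_poly:
  fixes f :: "'z::topological_space \<Rightarrow> nat \<Rightarrow> real"
  assumes "continuous_on UNIV f"
  shows "continuous_on UNIV (\<lambda>z. coeff (vec_poly n (f z)) k)"
proof -
  have "continuous_on UNIV (\<lambda>z. f z i)" for i
    using continuous_on_product_then_coordinatewise[OF assms] by blast
  then show ?thesis
    by (cases "k \<le> n") (auto simp: coeff_vec_poly coord_def Complex_eq intro!: continuous_intros)
qed

lemma continuous_poly_bounded_degree:
  fixes P :: "'z::topological_space \<Rightarrow> complex poly"
  assumes "\<And>k. continuous_on UNIV (\<lambda>x. coeff (P x) k)" "continuous_on UNIV z" "\<And>x. degree (P x) \<le> n"
  shows "continuous_on UNIV (\<lambda>x. poly (P x) (z x))"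
  unfolding poly_eq_sum_coeff[OF assms(3)] using assms(1,2) by (intro continuous_intros)

section \<open>Almost every polynomial is squarefree\<close>

definition double_root :: "complex poly \<Rightarrow> bool" where
  "double_root p \<longleftrightarrow> (\<exists>z. poly p z = 0 \<and> poly (pderiv p) z = 0)"

lemma sets_double_root:
  "{w \<in> space (lborel_pow (2 * Suc n)). double_root (vec_poly n w)} \<in> sets (lborel_pow (2 * Suc n))"
proof -
  define C :: "nat \<Rightarrow> ((nat \<Rightarrow> real) \<times> (nat \<Rightarrow> real)) set" where
    "C r = {z. poly (vec_poly n (fst z)) (coord (snd z) 0) = 0 \<and>
               poly (pderiv (vec_poly n (fst z))) (coord (snd z) 0) = 0}" for r
  have c: "continuous_on UNIV (\<lambda>z::(nat \<Rightarrow> real) \<times> (nat \<Rightarrow> real). coeff (vec_poly n (fst z)) k)" for k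
    by (intro continuous_coeff_vec_poly continuous_intros)
  have z: "continuous_on UNIV (\<lambda>z::(nat \<Rightarrow> real) \<times> (nat \<Rightarrow> real). coord (snd z) 0)"
    using continuous_coeff_vec_poly[of "snd :: (nat \<Rightarrow> real) \<times> (nat \<Rightarrow> real) \<Rightarrow> _" n 0]
    by (simp add: coeff_vec_poly continuous_on_snd continuous_on_id)
  have "closed (C r)" for r
    unfolding C_def
    by (intro closed_Collect_conj closed_Collect_eq continuous_on_const
        continuous_poly_bounded_degree[OF _ z, where n=n])
      (auto simp: coeff_pderiv degree_pderiv intro!: continuous_intros c degree_vec_poly order.trans[OF diff_le_self])
  from sets_projection_of_closed[where C=C and e=2 and d="2 * Suc n", OF this]
  have "{w \<in> space (lborel_pow (2 * Suc n)). \<exists>(r::nat) \<eta>. (\<forall>i\<ge>2. \<eta> i = 0) \<and> (zero_ext (2 * Suc n) w, \<eta>) \<in> C r}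
     \<in> sets (lborel_pow (2 * Suc n))" .
  moreover have "(\<exists>(r::nat) \<eta>. (\<forall>i\<ge>2. \<eta> i = 0) \<and> (zero_ext (2 * Suc n) w, \<eta>) \<in> C r) \<longleftrightarrow> double_root (vec_poly n w)" for w
  proof
    assume "double_root (vec_poly n w)"
    then obtain z where z: "poly (vec_poly n w) z = 0" "poly (pderiv (vec_poly n w)) z = 0"
      by (auto simp: double_root_def)
    define \<eta> where "\<eta> = (\<lambda>i::nat. if i = 0 then Re z else if i = 1 then Im z else 0)"
    have "coord \<eta> 0 = z" by (simp add: coord_def \<eta>_def)
    then have "(\<forall>i\<ge>2. \<eta> i = 0) \<and> (zero_ext (2 * Suc n) w, \<eta>) \<in> C 0"
      using z by (simp add: C_def vec_poly_zero_ext del: mult_Suc_right) (simp add: \<eta>_def)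
    then show "\<exists>(r::nat) \<eta>. (\<forall>i\<ge>2. \<eta> i = 0) \<and> (zero_ext (2 * Suc n) w, \<eta>) \<in> C r" by blast
  next
    assume "\<exists>(r::nat) \<eta>. (\<forall>i\<ge>2. \<eta> i = 0) \<and> (zero_ext (2 * Suc n) w, \<eta>) \<in> C r"
    then show "double_root (vec_poly n w)" unfolding double_root_def C_def by (auto simp: vec_poly_zero_ext simp del: mult_Suc_right)
  qed
  ultimately show ?thesis by (simp only:)
qed

text \<open>Adding a constant \<open>g\<close> to \<open>p\<close> produces a double root only if \<open>- g\<close>
  is one of the finitely many critical values of \<open>p\<close>.\<close>

lemma AE_no_double_root:
  assumes "n \<ge> 1"
  shows "AE w in lborel_pow (2 * Suc n). \<not> double_root (vec_poly n w)"
proof -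
  let ?M = "lborel_pow (2 * Suc n)"
  define B where "B = {w \<in> space ?M. double_root (vec_poly n w)}"
  have B: "B \<in> sets ?M" unfolding B_def by (rule sets_double_root)
  have "AE w in ?M. AE g in (lborel :: complex measure). vadd (2 * Suc n) w (poly_vec n (smult g 1)) \<notin> B"
    using AE_coord_nonzero[OF order_refl]
  proof eventually_elim
    case (elim w)
    define p where "p = vec_poly n w"
    have "coeff p n \<noteq> 0" using elim by (simp add: p_def coeff_vec_poly)
    then have "degree p \<noteq> 0" using assms by (metis le_degree not_one_le_zero le_zero_eq)
    then have "pderiv p \<noteq> 0" by (simp add: pderiv_eq_0_iff)
    then have fin: "finite ((\<lambda>z. - poly p z) ` {z. poly (pderiv p) z = 0})"
      by (intro finite_imageI poly_roots_finite)
    have "g \<in> (\<lambda>z. - poly p z) ` {z. poly (pderiv p) z = 0}"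
      if "vadd (2 * Suc n) w (poly_vec n (smult g 1)) \<in> B" for g
    proof -
      have "double_root (p + smult g 1)"
        using that unfolding B_def by (simp add: vec_poly_vadd vec_poly_poly_vec p_def del: mult_Suc_right)
      then obtain z where z: "poly (p + smult g 1) z = 0" "poly (pderiv (p + smult g 1)) z = 0"
        by (auto simp: double_root_def)
      have "pderiv (p + smult g 1) = pderiv p" by (simp add: pderiv_add pderiv_smult)
      then have "poly (pderiv p) z = 0" using z(2) by simp
      moreover have "g = - poly p z" using z(1) by (simp add: add_eq_0_iff)
      ultimately show ?thesis by blast
    qed
    with AE_lborel_notin_finite[OF fin] show ?case by (auto elim!: eventually_mono)
  qed
  then have "AE w in ?M. w \<notin> B" by (rule AE_of_perturbation[OF B])
  with AE_space show ?thesis by eventually_elim (simp add: B_def)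
qed

lemma squarefree_flip_prod:
  fixes p :: "complex poly"
  assumes "rsquarefree p"
  obtains \<beta> where "inj_on \<beta> {..<degree p}"
    "p = smult (lead_coeff p) (flip_prod (\<lambda>j. - \<beta> j) (\<lambda>_. 1) {..<degree p} {})"
proof -
  define R where "R = {z. poly p z = 0}"
  have dec: "smult (lead_coeff p) (\<Prod>z\<in>R. [:- z, 1:]) = p"
    unfolding R_def by (rule complex_poly_decompose_rsquarefree[OF assms])
  have p0: "p \<noteq> 0" using assms by (simp add: rsquarefree_def)
  then have "finite R" unfolding R_def by (rule poly_roots_finite)
  then obtain \<beta> where "bij_betw \<beta> {0..<card R} R" using ex_bij_betw_nat_finite by blast
  then have \<beta>: "bij_betw \<beta> {..<card R} R" by (simp add: atLeast0LessThan)
  have "degree p = degree (\<Prod>z\<in>R. [:- z, 1:])"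
    using p0 by (subst dec[symmetric]) simp
  also have "\<dots> = card R" by (subst degree_prod_eq_sum_degree) simp_all
  finally have deg: "degree p = card R" .
  have "(\<Prod>z\<in>R. [:- z, 1:]) = flip_prod (\<lambda>j. - \<beta> j) (\<lambda>_. 1) {..<degree p} {}"
    unfolding flip_prod_def deg by (subst prod.reindex_bij_betw[OF \<beta>, symmetric]) simp
  then show ?thesis using that[of \<beta>] \<beta> dec by (simp add: deg bij_betw_def)
qed

section \<open>Ambiguous polynomials\<close>

text \<open>The conditions on \<open>X\<close> under which the phases at \<open>k1\<close> and \<open>k2\<close> may
  fail to single out the expected solutions, weakened to the reality of the phase form. All of them are
  closed or open in the coefficients of \<open>X\<close> and \<open>Y\<close>.\<close>

definition ambiguous :: "nat \<Rightarrow> nat \<Rightarrow> nat \<Rightarrow> complex poly \<Rightarrow> bool" where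
  "ambiguous n k1 k2 X \<longleftrightarrow> coeff X 0 \<noteq> 0 \<and> coeff X n \<noteq> 0 \<and>
     (\<exists>Y. degree Y \<le> n \<and> (\<forall>z. cmod z = 1 \<longrightarrow> cmod (poly Y z) = cmod (poly X z)) \<and>
          Im (phase_form k1 k2 Y X) = 0 \<and> (\<nexists>c. Y = smult c X) \<and>
          (k1 + k2 = n \<longrightarrow> (\<nexists>c. Y = smult c (creflect n X))))"

text \<open>For \<open>P\<close> and \<open>Q \<noteq> 0\<close> of degree at most \<open>n\<close> this vanishes
  exactly when \<open>P\<close> is a multiple of \<open>Q\<close>; it turns non-proportionality into the
  positivity of a continuous function.\<close>

definition minors :: "nat \<Rightarrow> complex poly \<Rightarrow> complex poly \<Rightarrow> real" where
  "minors n P Q = (\<Sum>i\<le>n. \<Sum>j\<le>n. cmod (coeff P i * coeff Q j - coeff P j * coeff Q i))"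

lemma minors_pos_iff:
  assumes "degree P \<le> n" "degree Q \<le> n" "Q \<noteq> 0"
  shows "minors n P Q > 0 \<longleftrightarrow> (\<nexists>c. P = smult c Q)"
proof -
  have nonneg: "minors n P Q \<ge> 0" by (simp add: minors_def sum_nonneg)
  have "minors n P Q = 0 \<longleftrightarrow> (\<forall>i\<le>n. \<forall>j\<le>n. coeff P i * coeff Q j = coeff P j * coeff Q i)"
    by (auto simp: minors_def sum_nonneg_eq_0_iff sum_nonneg)
  also have "\<dots> \<longleftrightarrow> (\<exists>c. P = smult c Q)"
  proof
    assume *: "\<forall>i\<le>n. \<forall>j\<le>n. coeff P i * coeff Q j = coeff P j * coeff Q i"
    define m where "m = degree Q"
    have m: "m \<le> n" "coeff Q m \<noteq> 0" using assms by (simp_all add: m_def)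
    have "P = smult (coeff P m / coeff Q m) Q"
    proof (rule poly_eqI)
      fix i
      show "coeff P i = coeff (smult (coeff P m / coeff Q m) Q) i"
      proof (cases "i \<le> n")
        case True
        then show ?thesis using *[rule_format, OF True m(1)] m(2) by (simp add: field_simps)
      next
        case False
        then show ?thesis using assms(1,2) by (simp add: coeff_eq_0)
      qed
    qed
    then show "\<exists>c. P = smult c Q" by blast
  qed (auto simp: mult_ac)
  finally show ?thesis using nonneg by (auto simp: less_le)
qed

text \<open>The conditions on the pair \<open>(X, Y)\<close> are the closed conditions \<open>D\<close> and the
  positivity of the continuous function \<open>F\<close>. Replacing \<open>F > 0\<close> by \<open>F \<ge>
  1 / (r + 1)\<close> gives closed sets exhausting it, and the set is a countable union of projections.\<close>

lemma sets_ambiguous: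
  "{w \<in> space (lborel_pow (2 * Suc n)). ambiguous n k1 k2 (vec_poly n w)} \<in> sets (lborel_pow (2 * Suc n))"
proof -
  let ?vp = "vec_poly n"
  define F :: "(nat \<Rightarrow> real) \<times> (nat \<Rightarrow> real) \<Rightarrow> real" where
    "F z = cmod (coeff (?vp (fst z)) 0) * cmod (coeff (?vp (fst z)) n) * minors n (?vp (snd z)) (?vp (fst z)) *
       (if k1 + k2 = n then minors n (?vp (snd z)) (creflect n (?vp (fst z))) else 1)" for z
  define D :: "((nat \<Rightarrow> real) \<times> (nat \<Rightarrow> real)) set" where
    "D = (\<Inter>u\<in>{u. cmod u = 1}. {z. cmod (poly (?vp (snd z)) u) = cmod (poly (?vp (fst z)) u)}) \<inter>
         {z. Im (phase_form k1 k2 (?vp (snd z)) (?vp (fst z))) = 0}"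
  define C where "C r = D \<inter> {z. inverse (real (Suc r)) \<le> F z}" for r
  have c1: "continuous_on UNIV (\<lambda>z::(nat \<Rightarrow> real) \<times> (nat \<Rightarrow> real). coeff (?vp (fst z)) k)" for k
    by (intro continuous_coeff_vec_poly continuous_intros)
  have c2: "continuous_on UNIV (\<lambda>z::(nat \<Rightarrow> real) \<times> (nat \<Rightarrow> real). coeff (?vp (snd z)) k)" for k
    by (intro continuous_coeff_vec_poly continuous_intros)
  have c3: "continuous_on UNIV (\<lambda>z::(nat \<Rightarrow> real) \<times> (nat \<Rightarrow> real). coeff (creflect n (?vp (fst z))) k)" for k
    by (cases "k \<le> n") (auto simp: coeff_creflect intro!: continuous_intros c1)
  have cF: "continuous_on UNIV F"
  proof (cases "k1 + k2 = n")
    case True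
    show ?thesis unfolding F_def[abs_def] if_P[OF True] minors_def
      by (intro continuous_intros c1 c2 c3)
  next
    case False
    show ?thesis unfolding F_def[abs_def] if_not_P[OF False] minors_def
      by (intro continuous_intros c1 c2 c3)
  qed
  have D_iff: "(w, \<eta>) \<in> D \<longleftrightarrow>
      (\<forall>u. cmod u = 1 \<longrightarrow> cmod (poly (?vp \<eta>) u) = cmod (poly (?vp w) u)) \<and>
      Im (phase_form k1 k2 (?vp \<eta>) (?vp w)) = 0" for w \<eta>
    by (simp add: D_def)
  have "closed D"
    unfolding D_def phase_form_def
    by (intro closed_Int closed_INT ballI closed_Collect_eq continuous_on_const
        continuous_on_norm continuous_on_Im continuous_on_mult continuous_on_cnj
        continuous_poly_bounded_degree[where n=n] degree_vec_poly c1 c2)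
  then have "closed (C r)" for r
    unfolding C_def by (intro closed_Int closed_Collect_le continuous_on_const cF)
  from sets_projection_of_closed[where C=C and e="2 * Suc n" and d="2 * Suc n", OF this]
  have "{w \<in> space (lborel_pow (2 * Suc n)). \<exists>r \<eta>. (\<forall>i\<ge>2 * Suc n. \<eta> i = 0) \<and> (zero_ext (2 * Suc n) w, \<eta>) \<in> C r}
     \<in> sets (lborel_pow (2 * Suc n))" .
  moreover have "(\<exists>r \<eta>. (\<forall>i\<ge>2 * Suc n. \<eta> i = 0) \<and> (zero_ext (2 * Suc n) w, \<eta>) \<in> C r) \<longleftrightarrow>
      ambiguous n k1 k2 (?vp w)" (is "?L \<longleftrightarrow> ?R") for w
  proof -
    have key: "coeff (?vp w) 0 \<noteq> 0 \<and> coeff (?vp w) n \<noteq> 0 \<and> (\<nexists>c. ?vp \<eta> = smult c (?vp w)) \<and>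
       (k1 + k2 = n \<longrightarrow> (\<nexists>c. ?vp \<eta> = smult c (creflect n (?vp w)))) \<longleftrightarrow> F (zero_ext (2 * Suc n) w, \<eta>) > 0" for \<eta>
    proof (cases "coeff (?vp w) 0 = 0 \<or> coeff (?vp w) n = 0")
      case True
      then show ?thesis unfolding F_def fst_conv snd_conv vec_poly_zero_ext by auto
    next
      case False
      then have nz: "?vp w \<noteq> 0" by auto
      have "coeff (creflect n (?vp w)) n \<noteq> 0" using False by (simp add: coeff_creflect)
      then have nz': "creflect n (?vp w) \<noteq> 0" by auto
      have nonneg: "minors n P Q \<ge> 0" for P Q by (simp add: minors_def sum_nonneg)
      show ?thesis
        unfolding F_def fst_conv snd_conv vec_poly_zero_ext
          minors_pos_iff[OF degree_vec_poly degree_vec_poly nz, symmetric]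
          minors_pos_iff[OF degree_vec_poly degree_creflect nz', symmetric]
        using False nonneg by (simp add: zero_less_mult_iff not_less[symmetric])
    qed
    have arch: "x > 0 \<longleftrightarrow> (\<exists>r. inverse (real (Suc r)) \<le> x)" for x :: real
    proof
      assume "x > 0"
      then obtain r where "inverse (real (Suc r)) < x" using reals_Archimedean by blast
      then show "\<exists>r. inverse (real (Suc r)) \<le> x" by (auto intro: less_imp_le)
    next
      assume "\<exists>r. inverse (real (Suc r)) \<le> x"
      then obtain r where "inverse (real (Suc r)) \<le> x" by blast
      moreover have "inverse (real (Suc r)) > 0" by simp
      ultimately show "x > 0" by linarith
    qed
    have "?L \<longleftrightarrow> (\<exists>\<eta>. (\<forall>i\<ge>2 * Suc n. \<eta> i = 0) \<and> (zero_ext (2 * Suc n) w, \<eta>) \<in> D \<and> F (zero_ext (2 * Suc n) w, \<eta>) > 0)"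
      unfolding arch C_def by blast
    also have "\<dots> \<longleftrightarrow> ?R"
    proof
      assume "\<exists>\<eta>. (\<forall>i\<ge>2 * Suc n. \<eta> i = 0) \<and> (zero_ext (2 * Suc n) w, \<eta>) \<in> D \<and> F (zero_ext (2 * Suc n) w, \<eta>) > 0"
      then obtain \<eta> where "(zero_ext (2 * Suc n) w, \<eta>) \<in> D" "F (zero_ext (2 * Suc n) w, \<eta>) > 0" by blast
      then show ?R
        unfolding key[symmetric] ambiguous_def D_iff vec_poly_zero_ext
        using degree_vec_poly[of n \<eta>] by blast
    next
      assume ?R
      then obtain Y where Y: "coeff (?vp w) 0 \<noteq> 0" "coeff (?vp w) n \<noteq> 0" "degree Y \<le> n"
        "\<forall>z. cmod z = 1 \<longrightarrow> cmod (poly Y z) = cmod (poly (?vp w) z)" "Im (phase_form k1 k2 Y (?vp w)) = 0"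
        "\<nexists>c. Y = smult c (?vp w)" "k1 + k2 = n \<longrightarrow> (\<nexists>c. Y = smult c (creflect n (?vp w)))"
        unfolding ambiguous_def by blast
      define \<eta> where "\<eta> = zero_ext (2 * Suc n) (poly_vec n Y)"
      have v: "?vp \<eta> = Y" unfolding \<eta>_def vec_poly_zero_ext by (rule vec_poly_poly_vec[OF Y(3)])
      have "\<forall>i\<ge>2 * Suc n. \<eta> i = 0" by (simp add: \<eta>_def zero_ext_def)
      moreover have "(zero_ext (2 * Suc n) w, \<eta>) \<in> D"
        unfolding D_iff vec_poly_zero_ext v using Y by blast
      moreover have "F (zero_ext (2 * Suc n) w, \<eta>) > 0"
        unfolding key[symmetric] v using Y by blast
      ultimately show "\<exists>\<eta>. (\<forall>i\<ge>2 * Suc n. \<eta> i = 0) \<and> (zero_ext (2 * Suc n) w, \<eta>) \<in> D \<and> F (zero_ext (2 * Suc n) w, \<eta>) > 0"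
        by blast
    qed
    finally show ?thesis .
  qed
  ultimately show ?thesis by (simp only:)
qed

text \<open>Every candidate \<open>Y\<close> comes from a set \<open>J\<close> of reflected factors. The two sets
  which give multiples of \<open>X\<close> and of its reflection are those that the ambiguity conditions
  rule out; for the others the phase form is not real.\<close>

lemma not_ambiguous_product:
  fixes c d :: "nat \<Rightarrow> complex" and s :: real
  assumes nonreal: "\<And>J. J \<subseteq> {..<n} \<Longrightarrow> admissible n k1 k2 s (card J) \<Longrightarrow>
      Im (phase_form k1 k2 (flip_prod c d {..<n} J) (flip_prod c d {..<n} {})) \<noteq> 0"
    and s: "s = (if k1 + k2 = n then 1 / 2 else 1)"
    and X: "X = smult b (flip_prod c d {..<n} {})"
  shows "\<not> ambiguous n k1 k2 X"
proof
  assume "ambiguous n k1 k2 X"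
  then obtain Y where X0: "coeff X 0 \<noteq> 0" and Xn: "coeff X n \<noteq> 0" and dY: "degree Y \<le> n"
    and mod: "\<And>z. cmod z = 1 \<Longrightarrow> cmod (poly Y z) = cmod (poly X z)"
    and ph: "Im (phase_form k1 k2 Y X) = 0" and nX: "\<nexists>a. Y = smult a X"
    and nR: "k1 + k2 = n \<longrightarrow> (\<nexists>a. Y = smult a (creflect n X))"
    unfolding ambiguous_def by blast
  have b: "b \<noteq> 0" using X0 X by auto
  have refl: "creflect n (flip_prod c d {..<n} {}) = flip_prod c d {..<n} {..<n}"
    using creflect_flip_prod[of "{..<n}" c d] by simp
  have c0: "coeff (flip_prod c d {..<n} {}) 0 = (\<Prod>j<n. c j)"
    by (simp add: flip_prod_def poly_0_coeff_0[symmetric] poly_prod)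
  have "cnj (coeff (flip_prod c d {..<n} {}) n) = coeff (creflect n (flip_prod c d {..<n} {})) 0"
    by (simp add: coeff_creflect)
  also have "\<dots> = (\<Prod>j<n. cnj (d j))"
    unfolding refl by (simp add: flip_prod_def poly_0_coeff_0[symmetric] poly_prod)
  finally have cn: "cnj (coeff (flip_prod c d {..<n} {}) n) = (\<Prod>j<n. cnj (d j))" .
  have "coeff (flip_prod c d {..<n} {}) n \<noteq> 0" using Xn X by auto
  then have "(\<Prod>j<n. cnj (d j)) \<noteq> 0" unfolding cn[symmetric] by simp
  moreover have "(\<Prod>j<n. c j) \<noteq> 0" using X0 X c0 by auto
  ultimately have nz: "c j \<noteq> 0 \<and> d j \<noteq> 0" if "j \<in> {..<n}" for j using that by auto
  have "{z. cmod z = 1 \<and> cmod (poly Y z) \<noteq> cmod b * cmod (poly (flip_prod c d {..<n} {}) z)} = {}"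
    using mod by (auto simp: X norm_mult)
  then have fin: "finite {z. cmod z = 1 \<and> cmod (poly Y z) \<noteq> cmod b * cmod (poly (flip_prod c d {..<n} {}) z)}"
    by (simp only: finite.emptyI)
  then obtain J a where J: "J \<subseteq> {..<n}" and Y: "Y = smult a (flip_prod c d {..<n} J)"
    using same_modulus_on_circle_imp_flip_prod[OF _ nz _ fin] dY by auto
  have a: "a \<noteq> 0" using nX Y by (metis smult_0_left)
  have "J \<noteq> {}"
  proof
    assume "J = {}"
    then have "Y = smult (a / b) X" using Y X b by simp
    then show False using nX by blast
  qed
  moreover have "J \<noteq> {..<n}" if "k1 + k2 = n"
  proof
    assume "J = {..<n}"
    then have "Y = smult (a / cnj b) (creflect n X)" using Y X b by (simp add: creflect_smult refl)
    then show False using nR that by blast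
  qed
  moreover have "finite J" "card J \<le> n" using J finite_subset[OF J] card_mono[OF _ J] by auto
  ultimately have "admissible n k1 k2 s (card J)"
    using s J psubset_card_mono[of "{..<n}" J] by (auto simp: admissible_def Suc_le_eq card_gt_0_iff)
  from nonreal[OF J this] show False
    using ph a b by (simp add: X Y phase_form_smult)
qed

lemma AE_phase_form_nonreal:
  fixes \<beta> :: "nat \<Rightarrow> complex" and s :: real
  assumes k: "1 \<le> k1" "k1 < n" "1 \<le> k2" "k2 < n" "k1 \<noteq> k2"
    and inj: "inj_on \<beta> {..<n}" and J: "J \<subseteq> {..<n}" and adm: "admissible n k1 k2 s (card J)"
  shows "AE g in (lborel :: (complex \<times> complex) measure). Im (phase_form k1 k2
     (flip_prod (\<lambda>j. snd g - of_real s * \<beta> j) (\<lambda>j. fst g - \<beta> j) {..<n} J)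
     (flip_prod (\<lambda>j. snd g - of_real s * \<beta> j) (\<lambda>j. fst g - \<beta> j) {..<n} {})) \<noteq> 0"
proof -
  define W where "W g = phase_form k1 k2
     (flip_prod (\<lambda>j. snd g - of_real s * \<beta> j) (\<lambda>j. fst g - \<beta> j) {..<n} J)
     (flip_prod (\<lambda>j. snd g - of_real s * \<beta> j) (\<lambda>j. fst g - \<beta> j) {..<n} {})" for g :: "complex \<times> complex"
  have W_mem: "(\<lambda>x. W (h x)) \<in> F" if F: "conj_subring F"
    and "(\<lambda>x. fst (h x)) \<in> F" "(\<lambda>x. snd (h x)) \<in> F" for F and h :: "'x \<Rightarrow> complex \<times> complex"
  proof -
    have "(\<lambda>x. snd (h x) - of_real s * \<beta> j) \<in> F" "(\<lambda>x. fst (h x) - \<beta> j) \<in> F" for j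
      using conj_subringD(2)[OF F that(3) conj_subringD(1)[OF F, of "- of_real s * \<beta> j"]]
        conj_subringD(2)[OF F that(2) conj_subringD(1)[OF F, of "- \<beta> j"]] by simp_all
    then show ?thesis unfolding W_def
      by (intro conj_subring_phase_form[OF F] conj_subring_coeff_flip_prod[OF F]) simp_all
  qed
  obtain a b where ab: "Im (W (a, b)) \<noteq> 0"
    using phase_form_nonreal_on_orbit[OF k inj J adm] unfolding W_def by auto
  have "AE g in lborel. W g - cnj (W g) \<noteq> 0"
  proof (rule AE_lborel_nonzero_of_poly_on_rays)
    have "(\<lambda>x. W (id x)) \<in> {f. continuous_on UNIV f}"
      by (rule W_mem[OF conj_subring_continuous]) (auto intro!: continuous_intros)
    then show "continuous_on UNIV (\<lambda>g. W g - cnj (W g))" by (auto intro!: continuous_intros)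
    show "W (a, b) - cnj (W (a, b)) \<noteq> 0" using ab by (simp add: complex_eq_iff)
    fix x :: "complex \<times> complex"
    let ?P = "{f :: real \<Rightarrow> complex. \<exists>p. \<forall>t. f t = poly p (of_real t)}"
    have lin: "(\<lambda>t. u + t *\<^sub>R v) \<in> ?P" for u v :: complex
      by (auto simp: scaleR_conv_of_real intro!: exI[of _ "[:u, v:]"])
    have "(\<lambda>t. W ((a, b) + t *\<^sub>R x)) \<in> ?P"
      by (rule W_mem[OF conj_subring_real_poly]) (use lin in simp_all)
    then obtain p where p: "\<And>t. W ((a, b) + t *\<^sub>R x) = poly p (of_real t)" by blast
    have "W ((a, b) + t *\<^sub>R x) - cnj (W ((a, b) + t *\<^sub>R x)) = poly (p - map_poly cnj p) (of_real t)" for t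
      unfolding p by simp
    then show "\<exists>q. \<forall>t. W ((a, b) + t *\<^sub>R x) - cnj (W ((a, b) + t *\<^sub>R x)) = poly q (of_real t)" by blast
  qed
  then show ?thesis unfolding W_def[symmetric]
    by eventually_elim (simp add: complex_eq_iff)
qed

text \<open>The substitution $X \mapsto (z+s)^n X((az+b)/(z+s))$ on coordinate vectors, with \<open>g = (a,
  b)\<close>.\<close>

definition moebius_vec :: "nat \<Rightarrow> real \<Rightarrow> complex \<times> complex \<Rightarrow> (nat \<Rightarrow> real) \<Rightarrow> nat \<Rightarrow> real" where
  "moebius_vec n s g w = poly_vec n (hsubst n [:snd g, fst g:] [:of_real s, 1:] (vec_poly n w))"

lemma degree_hsubst_linear: "degree (hsubst n [:b, a:] [:s, 1:] p) \<le> n"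
  unfolding hsubst_def
proof (intro degree_sum_le finite_atMost order.trans[OF degree_smult_le] order.trans[OF degree_mult_le])
  fix k assume "k \<in> {..n}"
  moreover have "degree ([:b, a:] ^ k) \<le> 1 * k" for k
    by (rule order.trans[OF degree_power_le]) simp
  moreover have "degree ([:s, 1:] ^ (n - k)) \<le> 1 * (n - k)"
    by (rule order.trans[OF degree_power_le]) simp
  ultimately show "degree ([:b, a:] ^ k) + degree ([:s, 1:] ^ (n - k)) \<le> n"
    by (metis add_mono atMost_iff le_add_diff_inverse mult_1)
qed

lemma vec_poly_moebius_vec:
  "vec_poly n (moebius_vec n s g w) = hsubst n [:snd g, fst g:] [:of_real s, 1:] (vec_poly n w)"
  unfolding moebius_vec_def by (rule vec_poly_poly_vec[OF degree_hsubst_linear])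

lemma measurable_moebius_vec:
  "(\<lambda>(g, w). moebius_vec n s g w) \<in>
     measurable (lborel \<Otimes>\<^sub>M lborel_pow (2 * Suc n)) (lborel_pow (2 * Suc n))"
  unfolding moebius_vec_def case_prod_beta
proof (rule measurable_poly_vec)
  fix i
  let ?L = "lborel \<Otimes>\<^sub>M lborel_pow (2 * Suc n) :: ((complex \<times> complex) \<times> (nat \<Rightarrow> real)) measure"
  have "(\<lambda>g::complex \<times> complex. coeff ([:snd g, fst g:] ^ k * [:of_real s, 1:] ^ (n - k)) i) \<in> {f. continuous_on UNIV f}" for k
    by (intro conj_subring_coeff_mult conj_subring_coeff_power conj_subring_coeff_linear conj_subring_continuous)
      (auto intro!: continuous_intros)
  then have "(\<lambda>g::complex \<times> complex. coeff ([:snd g, fst g:] ^ k * [:of_real s, 1:] ^ (n - k)) i) \<in> borel_measurable lborel" for k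
    unfolding mem_Collect_eq measurable_lborel2 by (rule borel_measurable_continuous_onI)
  note m = this
  have 1: "(\<lambda>z. coeff ([:snd (fst z), fst (fst z):] ^ k * [:of_real s, 1:] ^ (n - k)) i) \<in> borel_measurable ?L" for k
    by (rule measurable_compose[OF measurable_fst m])
  have 2: "(\<lambda>z. coord (snd z) k) \<in> borel_measurable ?L" if "k \<le> n" for k
    by (rule measurable_compose[OF measurable_snd measurable_coord[OF that]])
  have 3: "(\<lambda>z. if k \<le> n then coord (snd z) k else 0) \<in> borel_measurable ?L" for k
    by (cases "k \<le> n") (simp_all only: if_True if_False 2 borel_measurable_const)
  show "(\<lambda>z. coeff (hsubst n [:snd (fst z), fst (fst z):] [:of_real s, 1:] (vec_poly n (snd z))) i) \<in> borel_measurable ?L"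
    unfolding hsubst_def coeff_sum coeff_smult coeff_vec_poly
    by (intro borel_measurable_sum borel_measurable_times 1 3)
qed

lemma measurable_moebius_vec_left:
  "moebius_vec n s g \<in> measurable (lborel_pow (2 * Suc n)) (lborel_pow (2 * Suc n))"
  using measurable_compose[OF measurable_Pair1' measurable_moebius_vec, of g] by simp

text \<open>For a squarefree \<open>X\<close> of degree \<open>n\<close>, almost every substitution moves
  \<open>X\<close> out of the ambiguous set, since only finitely many sets \<open>J\<close> of factors
  have to be considered. Fubini yields one invertible substitution that does so for almost every
  \<open>X\<close>.\<close>

lemma AE_not_ambiguous:
  assumes k: "1 \<le> k1" "k1 < n" "1 \<le> k2" "k2 < n" "k1 \<noteq> k2"
  shows "AE w in lborel_pow (2 * Suc n). \<not> ambiguous n k1 k2 (vec_poly n w)"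
proof -
  let ?M = "lborel_pow (2 * Suc n)"
  define s :: real where "s = (if k1 + k2 = n then 1 / 2 else 1)"
  define B where "B = {w \<in> space ?M. ambiguous n k1 k2 (vec_poly n w)}"
  have B: "B \<in> sets ?M" unfolding B_def by (rule sets_ambiguous)
  have n1: "n \<ge> 1" using k by simp
  have "AE w in ?M. AE g in lborel. moebius_vec n s g w \<notin> B"
    using AE_coord_nonzero[OF order_refl, of n] AE_no_double_root[OF n1]
  proof eventually_elim
    case (elim w)
    define p where "p = vec_poly n w"
    have "coeff p n \<noteq> 0" using elim by (simp add: p_def coeff_vec_poly)
    then have deg: "degree p = n" using degree_vec_poly[of n w] le_degree[of p n] by (simp add: p_def)
    then have p0: "p \<noteq> 0" using k by auto
    have "rsquarefree p"
      using elim by (simp add: rsquarefree_roots double_root_def p_def)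
    then obtain \<beta> where inj: "inj_on \<beta> {..<n}" and fac: "p = smult (lead_coeff p) (flip_prod (\<lambda>j. - \<beta> j) (\<lambda>_. 1) {..<n} {})"
      using squarefree_flip_prod deg by blast
    have "AE g in (lborel :: (complex \<times> complex) measure). \<forall>J\<in>{J \<in> Pow {..<n}. admissible n k1 k2 s (card J)}.
       Im (phase_form k1 k2
       (flip_prod (\<lambda>j. snd g - of_real s * \<beta> j) (\<lambda>j. fst g - \<beta> j) {..<n} J)
       (flip_prod (\<lambda>j. snd g - of_real s * \<beta> j) (\<lambda>j. fst g - \<beta> j) {..<n} {})) \<noteq> 0"
      by (rule AE_finite_allI) (auto intro!: AE_phase_form_nonreal[OF k inj])
    then show ?case
    proof eventually_elim
      case (elim g)
      have "hsubst n [:snd g, fst g:] [:of_real s, 1:] p =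
        smult (lead_coeff p) (\<Prod>j<n. smult 1 [:snd g, fst g:] + smult (- \<beta> j) [:of_real s, 1:])"
        by (subst fac) (use hsubst_flip_prod[of "{..<n}"] in \<open>simp add: hsubst_smult\<close>)
      also have "\<dots> = smult (lead_coeff p) (flip_prod (\<lambda>j. snd g - of_real s * \<beta> j) (\<lambda>j. fst g - \<beta> j) {..<n} {})"
        by (simp add: flip_prod_def mult_ac)
      finally have eq: "vec_poly n (moebius_vec n s g w) =
        smult (lead_coeff p) (flip_prod (\<lambda>j. snd g - of_real s * \<beta> j) (\<lambda>j. fst g - \<beta> j) {..<n} {})"
        unfolding vec_poly_moebius_vec p_def .
      have "\<not> ambiguous n k1 k2 (vec_poly n (moebius_vec n s g w))"
        by (rule not_ambiguous_product[OF _ s_def eq]) (use elim in blast)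
      then show ?case by (simp add: B_def)
    qed
  qed
  from AE_swap[OF lborel.sigma_finite_measure_axioms sigma_finite_lborel_pow measurable_moebius_vec B this]
  have "AE g in lborel. AE w in ?M. moebius_vec n s g w \<notin> B" .
  moreover have "AE g in (lborel :: (complex \<times> complex) measure). fst g * of_real s - snd g \<noteq> 0"
  proof (rule AE_lborel_nonzero_of_poly_on_rays[where ?p0.0="(0, 1)"])
    fix x :: "complex \<times> complex"
    have "fst ((0, 1) + t *\<^sub>R x) * of_real s - snd ((0, 1) + t *\<^sub>R x) = poly [:-1, fst x * of_real s - snd x:] (of_real t)" for t
      by (simp add: scaleR_conv_of_real algebra_simps)
    then show "\<exists>p. \<forall>t. fst ((0, 1) + t *\<^sub>R x) * of_real s - snd ((0, 1) + t *\<^sub>R x) = poly p (of_real t)" by blast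
  qed (auto intro!: continuous_intros)
  ultimately have "AE g in lborel. (AE w in ?M. moebius_vec n s g w \<notin> B) \<and> fst g * of_real s \<noteq> snd g"
    by eventually_elim simp
  then obtain g where g: "AE w in ?M. moebius_vec n s g w \<notin> B" "fst g * of_real s \<noteq> snd g"
    by (rule AE_exists[rotated]) (blast, simp)
  have "AE w in ?M. w \<notin> B"
  proof (rule AE_surj_additive[OF measurable_moebius_vec_left _ _ B g(1)])
    show "moebius_vec n s g (vadd (2 * Suc n) x v) = vadd (2 * Suc n) (moebius_vec n s g x) (moebius_vec n s g v)" for x v
      unfolding moebius_vec_def vec_poly_vadd hsubst_add poly_vec_add ..
    fix y assume y: "y \<in> space ?M"
    obtain p where p: "degree p \<le> n" "hsubst n [:snd g, fst g:] [:of_real s, 1:] p = vec_poly n y"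
      using hsubst_surj[OF g(2) degree_vec_poly] by blast
    have "moebius_vec n s g (poly_vec n p) = y"
      unfolding moebius_vec_def vec_poly_poly_vec[OF p(1)] p(2) by (rule poly_vec_vec_poly[OF y])
    then show "\<exists>x. moebius_vec n s g x = y" by blast
  qed
  with AE_space show ?thesis by eventually_elim (simp add: B_def)
qed

section \<open>Signals and their Fourier intensities\<close>

definition signal_poly :: "nat \<Rightarrow> signal \<Rightarrow> complex poly" where
  "signal_poly n x = (\<Sum>k\<le>n. monom (x (int k)) k)"

lemma coeff_signal_poly: "coeff (signal_poly n x) k = (if k \<le> n then x (int k) else 0)"
  by (simp add: signal_poly_def coeff_sum)

lemma degree_signal_poly: "degree (signal_poly n x) \<le> n"
  by (rule degree_le) (simp add: coeff_signal_poly)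

lemma vec_poly_signal_coords: "vec_poly n (signal_coords (Suc n) x) = signal_poly n x"
  by (rule poly_eqI)
    (auto simp: coeff_vec_poly coeff_signal_poly coord_def signal_coords_def complex_eq_iff)

lemma signal_coords_in_space: "signal_coords N x \<in> space (lborel_pow (2 * N))"
  by (simp add: signal_coords_def space_PiM)

lemma fourier_eq_poly:
  assumes "has_support (Suc n) x"
  shows "fourier x \<omega> = poly (signal_poly n x) (cis (- \<omega>))"
proof -
  have x0: "x k = 0" if "k \<notin> int ` {..n}" for k
  proof -
    have "k \<notin> {0..int (Suc n) - 1}"
    proof
      assume "k \<in> {0..int (Suc n) - 1}"
      then have "k = int (nat k)" "nat k \<le> n" by auto
      then show False using that by blast
    qed
    then show ?thesis using assms unfolding has_support_def by blast
  qed
  have "fourier x \<omega> = (\<Sum>\<^sub>\<infinity>k\<in>int ` {..n}. x k * exp (- \<i> * of_real \<omega> * of_int k))"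
    unfolding fourier_def by (rule infsum_cong_neutral) (use x0 in auto)
  also have "\<dots> = (\<Sum>k\<in>int ` {..n}. x k * exp (- \<i> * of_real \<omega> * of_int k))"
    by (rule infsum_finite) simp
  also have "\<dots> = (\<Sum>k\<le>n. x (int k) * exp (- \<i> * of_real \<omega> * of_nat k))"
    by (subst sum.reindex) (auto simp: inj_on_def)
  also have "\<dots> = (\<Sum>k\<le>n. x (int k) * cis (- \<omega>) ^ k)"
    by (intro sum.cong refl) (simp add: cis_conv_exp exp_of_nat_mult[symmetric] mult_ac)
  also have "\<dots> = poly (signal_poly n x) (cis (- \<omega>))"
    by (simp add: signal_poly_def poly_sum poly_monom)
  finally show ?thesis .
qed

lemma fourier_intensity_eq_iff:
  assumes "has_support (Suc n) x" "has_support (Suc n) y"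
  shows "fourier_intensity y = fourier_intensity x \<longleftrightarrow>
    (\<forall>z. cmod z = 1 \<longrightarrow> cmod (poly (signal_poly n y) z) = cmod (poly (signal_poly n x) z))"
proof
  assume L: "fourier_intensity y = fourier_intensity x"
  show "\<forall>z. cmod z = 1 \<longrightarrow> cmod (poly (signal_poly n y) z) = cmod (poly (signal_poly n x) z)"
  proof (intro allI impI)
    fix z assume z: "cmod z = 1"
    then have "z = cis (- (- Arg z))" using rcis_cmod_Arg[of z] by (simp add: rcis_def)
    then show "cmod (poly (signal_poly n y) z) = cmod (poly (signal_poly n x) z)"
      using fun_cong[OF L, of "- Arg z"]
      unfolding fourier_intensity_def fourier_eq_poly[OF assms(1)] fourier_eq_poly[OF assms(2)] by simp
  qed
qed (auto simp: fourier_intensity_def fourier_eq_poly[OF assms(1)] fourier_eq_poly[OF assms(2)])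

lemma signal_eqI:
  assumes "has_support (Suc n) x" "has_support (Suc n) y" "\<And>k. k \<le> n \<Longrightarrow> y (int k) = x (int k)"
  shows "y = x"
proof
  fix k
  show "y k = x k"
  proof (cases "k \<in> {0..int (Suc n) - 1}")
    case True
    then have "k = int (nat k)" "nat k \<le> n" by auto
    then show ?thesis using assms(3)[of "nat k"] by simp
  next
    case False
    then show ?thesis using assms(1,2) unfolding has_support_def by metis
  qed
qed

lemma same_phase_imp_mult_cnj_real:
  assumes "same_phase z w"
  shows "Im (z * cnj w) = 0"
proof (cases "z = 0 \<or> w = 0")
  case False
  then have "Arg z = Arg w" using assms by (simp add: same_phase_def)
  then have "z = cmod z * cis (Arg w)" "w = cmod w * cis (Arg w)"
    using rcis_cmod_Arg[of z] rcis_cmod_Arg[of w] by (simp_all add: rcis_def)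
  then have "z * cnj w = (cmod z * cis (Arg w)) * cnj (cmod w * cis (Arg w))" by metis
  also have "\<dots> = of_real (cmod z * cmod w)" by (simp add: cis_cnj cis_mult)
  finally show ?thesis by (simp only: Im_complex_of_real)
qed auto

lemma constant_modulus_one:
  assumes "P \<noteq> 0" "\<forall>z. cmod z = 1 \<longrightarrow> cmod (poly (smult c P) z) = cmod (poly P z)"
  shows "cmod c = 1"
proof -
  have "infinite ({z. cmod z = 1} - {z. poly P z = 0})"
    using infinite_unit_circle poly_roots_finite[OF assms(1)] by simp
  then obtain z where "cmod z = 1" "poly P z \<noteq> 0" by (metis (mono_tags, lifting) DiffE finite.emptyI mem_Collect_eq ex_in_conv)
  then show ?thesis using assms(2) by (auto simp: norm_mult)
qed

text \<open>Outside the ambiguous set a solution is a multiple of \<open>X\<close> or, if \<open>k1 + k2 =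
  n\<close>, of its reflection. The constant is unimodular by comparison of intensities, and the phase at
  \<open>k1\<close>, where \<open>x\<close> does not vanish, determines it.\<close>

lemma generic_solutions:
  fixes l1 l2 :: int and x :: signal
  assumes sup: "has_support (Suc n) x"
    and k: "int k1 = int n - l1" "int k2 = int n - l2" "k1 \<le> n" "k2 \<le> n"
    and amb: "\<not> ambiguous n k1 k2 (signal_poly n x)"
    and nz: "x (int k1) \<noteq> 0" "x (int k2) \<noteq> 0"
  shows "solutions (Suc n) l1 l2 x =
    (if k1 + k2 = n then {x, conj_reflection (Suc n) l1 l2 x} else {x})"
proof -
  define X where "X = signal_poly n x"
  have idx: "int (Suc n) - 1 - l1 = int k1" "int (Suc n) - 1 - l2 = int k2" using k by simp_all
  have X0: "coeff X 0 \<noteq> 0" "coeff X n \<noteq> 0"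
    using sup by (simp_all add: X_def coeff_signal_poly has_support_def)
  then have Xnz: "X \<noteq> 0" by auto
  have sol: "y \<in> solutions (Suc n) l1 l2 x \<longleftrightarrow> has_support (Suc n) y \<and>
      (\<forall>z. cmod z = 1 \<longrightarrow> cmod (poly (signal_poly n y) z) = cmod (poly X z)) \<and>
      same_phase (y (int k1)) (x (int k1)) \<and> same_phase (y (int k2)) (x (int k2))" for y
    unfolding solutions_def mem_Collect_eq idx X_def using fourier_intensity_eq_iff[OF sup] by blast
  have x_sol: "x \<in> solutions (Suc n) l1 l2 x" using sup unfolding sol X_def by (simp add: same_phase_def)
  have polar: "z = cmod z * cis (Arg z)" for z
    using rcis_cmod_Arg[of z] by (simp add: rcis_def)
  have cases: "y = x \<or> (k1 + k2 = n \<and> y = conj_reflection (Suc n) l1 l2 x)"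
    if "y \<in> solutions (Suc n) l1 l2 x" for y
  proof -
    from that have supy: "has_support (Suc n) y"
      and mod: "\<forall>z. cmod z = 1 \<longrightarrow> cmod (poly (signal_poly n y) z) = cmod (poly X z)"
      and ph: "same_phase (y (int k1)) (x (int k1))" "same_phase (y (int k2)) (x (int k2))"
      unfolding sol by blast+
    define Y where "Y = signal_poly n y"
    have yY: "y (int j) = coeff Y j" and xX: "x (int j) = coeff X j" if "j \<le> n" for j
      using that by (simp_all add: Y_def X_def coeff_signal_poly)
    have "phase_form k1 k2 Y X = (y (int k1) * cnj (x (int k1))) * cnj (y (int k2) * cnj (x (int k2)))"
      unfolding phase_form_def yY[OF k(3)] yY[OF k(4)] xX[OF k(3)] xX[OF k(4)] by (simp add: mult_ac)
    moreover have "Im (a * cnj b) = 0" if "Im a = 0" "Im b = 0" for a b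
      using that by simp
    ultimately have "Im (phase_form k1 k2 Y X) = 0"
      using ph[THEN same_phase_imp_mult_cnj_real] by simp
    moreover have "degree Y \<le> n" by (simp add: Y_def degree_signal_poly)
    ultimately have "(\<exists>c. Y = smult c X) \<or> (k1 + k2 = n \<and> (\<exists>c. Y = smult c (creflect n X)))"
      using amb X0 mod unfolding ambiguous_def X_def[symmetric] Y_def[symmetric] by blast
    then show ?thesis
    proof (elim disjE conjE exE)
      fix c assume Y: "Y = smult c X"
      have "cmod c = 1" using mod unfolding Y_def[symmetric] Y by (rule constant_modulus_one[OF Xnz])
      then have c0: "c \<noteq> 0" by auto
      have yc: "y (int j) = c * x (int j)" if "j \<le> n" for j using yY[OF that] xX[OF that] Y by simp
      have "Arg (c * x (int k1)) = Arg (x (int k1))"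
        using ph(1) nz(1) c0 yc[OF k(3)] by (auto simp: same_phase_def)
      then have "c * x (int k1) = cmod (x (int k1)) * cis (Arg (x (int k1)))"
        using polar[of "c * x (int k1)"] \<open>cmod c = 1\<close> by (simp add: norm_mult)
      then have "c = 1" using polar[of "x (int k1)"] nz(1) by simp
      then show ?thesis using yc signal_eqI[OF sup supy] by simp
    next
      fix c assume kn: "k1 + k2 = n" and Y: "Y = smult c (creflect n X)"
      have degX: "degree X \<le> n" by (simp add: X_def degree_signal_poly)
      have "coeff (creflect n X) 0 \<noteq> 0" using X0 by (simp add: coeff_creflect)
      then have Rnz: "creflect n X \<noteq> 0" by auto
      have "cmod c = 1"
        by (rule constant_modulus_one[OF Rnz])
          (use mod in \<open>simp add: Y_def[symmetric] cmod_creflect_on_circle[OF degX] Y\<close>)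
      then have c0: "c \<noteq> 0" by auto
      have yc: "y (int j) = c * cnj (x (int (n - j)))" if "j \<le> n" for j
        using yY[OF that] xX[of "n - j"] Y that by (simp add: coeff_creflect)
      have nk: "n - k1 = k2" using kn by simp
      have "Arg (c * cnj (x (int k2))) = Arg (x (int k1))"
        using ph(1) nz c0 yc[OF k(3)] nk by (auto simp: same_phase_def)
      then have "c * cnj (x (int k2)) = cmod (x (int k2)) * cis (Arg (x (int k1)))"
        using polar[of "c * cnj (x (int k2))"] \<open>cmod c = 1\<close> by (simp add: norm_mult)
      moreover have "cnj (x (int k2)) = cmod (x (int k2)) * cis (- Arg (x (int k2)))"
        using arg_cong[OF polar[of "x (int k2)"], of cnj] by (simp add: cis_cnj)
      ultimately have "c * cis (- Arg (x (int k2))) = cis (Arg (x (int k1)))"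
        using nz(2) by simp
      then have "c * (cis (- Arg (x (int k2))) * cis (Arg (x (int k2)))) = cis (Arg (x (int k1))) * cis (Arg (x (int k2)))"
        by (metis mult.assoc)
      then have c: "c = exp (\<i> * of_real (Arg (x (int k1)) + Arg (x (int k2))))"
        by (simp add: cis_mult) (simp add: cis_conv_exp)
      have "y = conj_reflection (Suc n) l1 l2 x"
      proof
        fix j
        show "y j = conj_reflection (Suc n) l1 l2 x j"
        proof (cases "j \<in> {0..int (Suc n) - 1}")
          case True
          then have j: "j = int (nat j)" "nat j \<le> n" "int (Suc n) - 1 - j = int (n - nat j)" by auto
          show ?thesis unfolding conj_reflection_def idx j(3) using yc[OF j(2)] j(1) c by simp
        next
          case False
          then have "int (Suc n) - 1 - j \<notin> {0..int (Suc n) - 1}" by auto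
          then have "x (int (Suc n) - 1 - j) = 0" "y j = 0"
            using False sup supy unfolding has_support_def by blast+
          then show ?thesis unfolding conj_reflection_def by (simp only: complex_cnj_zero mult_zero_right)
        qed
      qed
      then show ?thesis using kn by blast
    qed
  qed
  have refl_sol: "conj_reflection (Suc n) l1 l2 x \<in> solutions (Suc n) l1 l2 x" if kn: "k1 + k2 = n"
  proof -
    define \<theta> where "\<theta> = Arg (x (int k1)) + Arg (x (int k2))"
    define y where "y = conj_reflection (Suc n) l1 l2 x"
    have y: "y j = cis \<theta> * cnj (x (int n - j))" for j
      unfolding y_def conj_reflection_def idx \<theta>_def by (simp add: cis_conv_exp)
    have supy: "has_support (Suc n) y"
      using sup unfolding has_support_def y by auto
    have "signal_poly n y = smult (cis \<theta>) (creflect n X)"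
      by (rule poly_eqI) (simp add: coeff_signal_poly coeff_creflect X_def y of_nat_diff)
    then have mod: "\<forall>z. cmod z = 1 \<longrightarrow> cmod (poly (signal_poly n y) z) = cmod (poly X z)"
      using cmod_creflect_on_circle[of X n] by (simp add: norm_mult X_def degree_signal_poly)
    have ph: "same_phase (y (int i)) (x (int i))"
      if "i + j = n" "\<theta> = Arg (x (int i)) + Arg (x (int j))" for i j
    proof (cases "x (int i) = 0 \<or> x (int j) = 0")
      case False
      have nij: "int n - int i = int j" using that(1) by simp
      have "cnj (x (int j)) = cmod (x (int j)) * cis (- Arg (x (int j)))"
        using arg_cong[OF polar[of "x (int j)"], of cnj] by (simp add: cis_cnj)
      then have "y (int i) = cis \<theta> * (cmod (x (int j)) * cis (- Arg (x (int j))))"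
        unfolding y nij by metis
      also have "\<dots> = rcis (cmod (x (int j))) (Arg (x (int i)))"
        using that(2) by (simp add: rcis_def cis_mult[symmetric] mult_ac) (simp add: cis_mult)
      finally have "Arg (y (int i)) = Arg (x (int i))"
        using False Arg_bounded[of "x (int i)"] by (simp add: Arg_rcis)
      then show ?thesis by (simp add: same_phase_def)
    next
      case True
      have nij: "int n - int i = int j" using that(1) by simp
      show ?thesis using True unfolding same_phase_def y nij by auto
    qed
    have "same_phase (y (int k1)) (x (int k1))" "same_phase (y (int k2)) (x (int k2))"
      using ph[of k1 k2] ph[of k2 k1] kn by (simp_all add: \<theta>_def add.commute)
    then show ?thesis unfolding sol y_def[symmetric] using supy mod by blast
  qed
  show ?thesis using x_sol cases refl_sol by auto
qed

theorem theorem4p7: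
  fixes N :: nat and l1 l2 :: int
  assumes "l1 \<noteq> l2"
    and "1 \<le> l1" "l1 \<le> int N - 2"
    and "1 \<le> l2" "l2 \<le> int N - 2"
  shows "(l1 + l2 \<noteq> int N - 1 \<longrightarrow>
            almost_every_signal N (\<lambda>x. solutions N l1 l2 x = {x})) \<and>
         (l1 + l2 = int N - 1 \<longrightarrow>
            almost_every_signal N
              (\<lambda>x. solutions N l1 l2 x = {x, conj_reflection N l1 l2 x}))"
proof -
  define n where "n = N - 1"
  have N: "N = Suc n" using assms(2,3) by (simp add: n_def)
  define k1 k2 where "k1 = nat (int n - l1)" and "k2 = nat (int n - l2)"
  have Ni: "int N = int n + 1" using N by simp
  have k: "int k1 = int n - l1" "int k2 = int n - l2"
    unfolding k1_def k2_def using assms Ni by linarith+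
  have kb: "1 \<le> k1" "k1 < n" "1 \<le> k2" "k2 < n" "k1 \<le> n" "k2 \<le> n"
    using k assms(2-5) Ni by linarith+
  have ne: "k1 \<noteq> k2" using k assms(1) by linarith
  have sym: "k1 + k2 = n \<longleftrightarrow> l1 + l2 = int N - 1"
    using k Ni by linarith
  let ?M = "lborel_pow (2 * Suc n)"
  have "AE w in ?M. \<not> ambiguous n k1 k2 (vec_poly n w) \<and> coord w k1 \<noteq> 0 \<and> coord w k2 \<noteq> 0"
    using AE_not_ambiguous[OF kb(1-4) ne] AE_coord_nonzero[OF kb(5)] AE_coord_nonzero[OF kb(6)]
    by eventually_elim simp
  then obtain Z where Z_sub:
    "{w \<in> space ?M. \<not> (\<not> ambiguous n k1 k2 (vec_poly n w) \<and> coord w k1 \<noteq> 0 \<and> coord w k2 \<noteq> 0)} \<subseteq> Z"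
    and "emeasure ?M Z = 0" "Z \<in> sets ?M"
    by (rule AE_E)
  then have Z: "Z \<in> null_sets ?M" by (intro null_setsI)
  have "almost_every_signal N (\<lambda>x. solutions N l1 l2 x =
    (if k1 + k2 = n then {x, conj_reflection N l1 l2 x} else {x}))"
    unfolding almost_every_signal_def
  proof (intro bexI[of _ Z] allI impI)
    show "Z \<in> null_sets (lebesgue_2N N)"
      unfolding lebesgue_2N_def N by (rule null_sets_completionI[OF Z])
    fix x assume sup: "has_support N x" and "signal_coords N x \<notin> Z"
    then have w: "\<not> ambiguous n k1 k2 (vec_poly n (signal_coords N x))"
      "coord (signal_coords N x) k1 \<noteq> 0" "coord (signal_coords N x) k2 \<noteq> 0"
      using Z_sub signal_coords_in_space[of N x] unfolding N by blast+
    have co: "coord (signal_coords N x) j = x (int j)" if "j \<le> n" for j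
      using arg_cong[OF vec_poly_signal_coords[of n x], of "\<lambda>p. coeff p j"] that
      by (simp add: coeff_vec_poly coeff_signal_poly N)
    have amb: "\<not> ambiguous n k1 k2 (signal_poly n x)"
      using w(1) unfolding N vec_poly_signal_coords .
    have nz: "x (int k1) \<noteq> 0" "x (int k2) \<noteq> 0"
      using w(2,3) unfolding co[OF kb(5)] co[OF kb(6)] .
    show "solutions N l1 l2 x = (if k1 + k2 = n then {x, conj_reflection N l1 l2 x} else {x})"
      unfolding N by (rule generic_solutions[OF sup[unfolded N] k kb(5,6) amb nz])
  qed
  then show ?thesis unfolding sym by (cases "l1 + l2 = int N - 1") simp_all
qed

end
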